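(* Let $d\ge2$ be an integer and $\alpha\in(0,1)$. There exists a constant $C=C(\alpha,d)>0$ such that $$\|I_\alpha D\chi_E\|_{L^{d/(d-\alpha),1}(\mathbb{R}^d;\mathbb{R}^d)}\le C\,\mathrm{Per}(E)^{1-\alpha}\,|E|^{\alpha(1-1/d)}$$ for all measurable sets $E\subset\mathbb{R}^d$ such that $\chi_E\in BV(\mathbb{R}^d)$.
   Context: $\chi_E$ is the characteristic function of $E$ and $|E|$ its Lebesgue measure. $BV(\mathbb{R}^d)$ is the set of $u\in L^1(\mathbb{R}^d)$ whose distributional derivative $Du$ is an $\mathbb{R}^d$-valued Radon measure of finite total mass. $\mathrm{Per}(E):=|D\chi_E|(\mathbb{R}^d)$ is the total variation of the measure $D\chi_E$. The Riesz potential of order $\alpha$ of an $\mathbb{R}^d$-valued finite Radon measure $F$ is $$I_\alpha F(x)=\frac{1}{\gamma(\alpha)}\int_{\mathbb{R}^d}\frac{dF(y)}{|x-y|^{d-\alpha}},\qquad \gamma(\alpha)=\frac{\pi^{d/2}2^\alpha\Gamma(\alpha/2)}{\Gamma((d-\alpha)/2)},$$ which is defined for Lebesgue almost every $x\in\mathbb{R}^d$. The Lorentz quasi-norm is $$\|g\|_{L^{d/(d-\alpha),1}}:=\int_0^\infty|\{|g|>t\}|^{(d-\alpha)/d}\,dt,$$ where for vector-valued $g$, $|g|$ denotes the pointwise Euclidean norm and $|\{\cdot\}|$ denotes Lebesgue measure. *)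

theory Defs
  imports "HOL-Analysis.Analysis"
begin

text \<open>
  Throughout, \<open>'a :: euclidean_space\<close> plays the role of \<open>\<real>\<^sup>d\<close>, with \<open>d = DIM('a)\<close>.

  A finite \<open>\<real>\<^sup>d\<close>-valued Radon measure is a countably additive set function on the Borel sets of
  \<open>\<real>\<^sup>d\<close> of finite total variation; Radon regularity is automatic for finite Borel measures on
  \<open>\<real>\<^sup>d\<close>. Only the values on Borel sets are relevant.
\<close>

definition vector_total_variation :: "('a::euclidean_space set \<Rightarrow> 'a) \<Rightarrow> 'a set \<Rightarrow> ennreal" where
  "vector_total_variation F A =
     (SUP P \<in> {P :: nat \<Rightarrow> 'a set. range P \<subseteq> sets borel \<and> disjoint_family P \<and> (\<Union>n. P n) = A}.
        (\<Sum>n. ennreal (norm (F (P n)))))"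

definition finite_vector_measure :: "('a::euclidean_space set \<Rightarrow> 'a) \<Rightarrow> bool" where
  "finite_vector_measure F \<longleftrightarrow>
     F {} = 0 \<and>
     (\<forall>A :: nat \<Rightarrow> 'a set. range A \<subseteq> sets borel \<longrightarrow> disjoint_family A \<longrightarrow>
        (\<lambda>n. F (A n)) sums F (\<Union>n. A n)) \<and>
     vector_total_variation F UNIV < \<infinity>"

text \<open>
  The positive part \<open>\<nu>\<^sup>+(A) = sup {\<nu>(B) | B \<subseteq> A Borel}\<close> in the Jordan decomposition of a finite signed
  Borel measure \<open>\<nu>\<close>; the negative part is the positive part of \<open>-\<nu>\<close>.
\<close>

definition jordan_pos :: "('a::euclidean_space set \<Rightarrow> real) \<Rightarrow> 'a measure" where
  "jordan_pos \<nu> =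
     measure_of UNIV (sets borel) (\<lambda>A. SUP B \<in> {B \<in> sets borel. B \<subseteq> A}. ennreal (\<nu> B))"

definition signed_integral :: "('a::euclidean_space set \<Rightarrow> real) \<Rightarrow> ('a \<Rightarrow> real) \<Rightarrow> real" where
  "signed_integral \<nu> f =
     (LINT y|jordan_pos \<nu>. f y) - (LINT y|jordan_pos (\<lambda>A. - \<nu> A). f y)"

definition vector_integral :: "('a::euclidean_space set \<Rightarrow> 'a) \<Rightarrow> ('a \<Rightarrow> real) \<Rightarrow> 'a" where
  "vector_integral F f = (\<Sum>i\<in>Basis. signed_integral (\<lambda>A. F A \<bullet> i) f *\<^sub>R i)"

primrec C_k :: "nat \<Rightarrow> ('a::euclidean_space \<Rightarrow> real) \<Rightarrow> bool" where
  "C_k 0 \<phi> \<longleftrightarrow> continuous_on UNIV \<phi>"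
| "C_k (Suc k) \<phi> \<longleftrightarrow>
     (\<forall>x. \<phi> differentiable (at x)) \<and> (\<forall>i\<in>Basis. C_k k (\<lambda>x. frechet_derivative \<phi> (at x) i))"

definition test_function :: "('a::euclidean_space \<Rightarrow> real) \<Rightarrow> bool" where
  "test_function \<phi> \<longleftrightarrow> (\<forall>k. C_k k \<phi>) \<and> compact (closure {x. \<phi> x \<noteq> 0})"

definition grad :: "('a::euclidean_space \<Rightarrow> real) \<Rightarrow> 'a \<Rightarrow> 'a" where
  "grad \<phi> x = (\<Sum>i\<in>Basis. frechet_derivative \<phi> (at x) i *\<^sub>R i)"

definition has_distr_derivative ::
    "('a::euclidean_space \<Rightarrow> real) \<Rightarrow> ('a set \<Rightarrow> 'a) \<Rightarrow> bool" where
  "has_distr_derivative u F \<longleftrightarrow>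
     (\<forall>\<phi>. test_function \<phi> \<longrightarrow>
        (LINT x|lebesgue. u x *\<^sub>R grad \<phi> x) = - vector_integral F \<phi>)"

definition BV :: "('a::euclidean_space \<Rightarrow> real) set" where
  "BV = {u. integrable lebesgue u \<and> (\<exists>F. finite_vector_measure F \<and> has_distr_derivative u F)}"

text \<open>
  For \<open>u \<in> BV\<close> the derivative measure is uniquely determined on Borel sets; the choice operator only
  fixes the irrelevant values of the set function on non-Borel sets.
\<close>

definition distr_derivative :: "('a::euclidean_space \<Rightarrow> real) \<Rightarrow> 'a set \<Rightarrow> 'a" where
  "distr_derivative u = (SOME F. finite_vector_measure F \<and> has_distr_derivative u F)"

definition perimeter :: "'a::euclidean_space set \<Rightarrow> ennreal" where
  "perimeter E = vector_total_variation (distr_derivative (indicator E)) UNIV"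

definition riesz_gamma :: "real \<Rightarrow> real \<Rightarrow> real" where
  "riesz_gamma d \<alpha> = pi powr (d / 2) * 2 powr \<alpha> * Gamma (\<alpha> / 2) / Gamma ((d - \<alpha>) / 2)"

text \<open>
  Where the defining integral does not converge absolutely (a Lebesgue null set of points \<open>x\<close>), the
  value below carries no meaning. The same null set contains every atom of \<open>F\<close>, so it does not
  matter that the kernel has the value \<open>1 / 0 = 0\<close> at \<open>y = x\<close>.
\<close>

definition riesz_potential ::
    "real \<Rightarrow> ('a::euclidean_space set \<Rightarrow> 'a) \<Rightarrow> 'a \<Rightarrow> 'a" where
  "riesz_potential \<alpha> F x =
     (1 / riesz_gamma (real DIM('a)) \<alpha>) *\<^sub>R
       vector_integral F (\<lambda>y. 1 / norm (x - y) powr (real DIM('a) - \<alpha>))"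

text \<open>Power with a positive real exponent on \<open>[0, \<infinity>]\<close>.\<close>

definition ennreal_powr :: "ennreal \<Rightarrow> real \<Rightarrow> ennreal" where
  "ennreal_powr x a = (if x = \<infinity> then \<infinity> else ennreal (enn2real x powr a))"

text \<open>The quasi-norm of the Lorentz space \<open>L\<^sup>p\<^sup>,\<^sup>1\<close>.\<close>

definition lorentz_norm1 ::
    "real \<Rightarrow> ('a::euclidean_space \<Rightarrow> 'b::euclidean_space) \<Rightarrow> ennreal" where
  "lorentz_norm1 p g =
     (\<integral>\<^sup>+t\<in>{0<..}. ennreal_powr (emeasure lebesgue {x. norm (g x) > t}) (1 / p) \<partial>lborel)"

end

theory Submission
  imports Defs
begin

text \<open>
  Write \<open>d\<close> for the dimension, \<open>P\<close> for the perimeter and \<open>V\<close> for the volume of \<open>E\<close>, and let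
  \<open>F = D\<chi>\<^sub>E\<close>. Suppose that at a point \<open>x\<close> all balls satisfy \<open>|F|(B(x,s)) \<le> a s\<^sup>d\<close> and
  \<open>|E \<inter> B(x,s)| \<le> b s\<^sup>d\<close>. The Riesz kernel is an integral over the scales \<open>s > 0\<close>, with weight
  \<open>s powr (\<alpha> - d - 1)\<close>, of smooth bumps supported in \<open>B(x,s)\<close>. Testing \<open>F\<close> with such a bump gives at
  most a multiple of \<open>a s\<^sup>d\<close> by the first bound and, after integration by parts, at most a multiple of
  \<open>b s powr (d - 1)\<close> by the second. Using the first for \<open>s \<le> b / a\<close> and the second for larger \<open>s\<close>
  gives \<open>|I\<^sub>\<alpha> F (x)| \<le> K a powr (1 - \<alpha>) b powr \<alpha>\<close> (\<open>norm_riesz_potential_le\<close>).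

  By Vitali's covering lemma the set of \<open>x\<close> violating the first bound has measure at most a multiple
  of \<open>P / a\<close>, the set violating the second at most a multiple of \<open>V / b\<close> (\<open>large_balls_covered\<close>), and
  the second set is empty when \<open>b\<close> is the volume of the unit ball. Choosing \<open>a\<close> and \<open>b\<close> with
  \<open>K a powr (1 - \<alpha>) b powr \<alpha> = t\<close> in two ways bounds the measure of \<open>{|I\<^sub>\<alpha> F| > t}\<close> by a multiple of
  \<open>P powr (1 - \<alpha>) V powr \<alpha> / t\<close> and by a multiple of \<open>P t powr (- 1 / (1 - \<alpha>))\<close>. Raised to the power
  \<open>1 - \<alpha> / d\<close>, the first bound is integrable at \<open>0\<close> and the second at infinity, the latter because
  \<open>d > 1\<close>. Splitting the Lorentz integral at \<open>t = (P / V) powr (1 - \<alpha>)\<close> gives the theorem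
  (\<open>lorentz_norm_riesz_potential_le\<close>).

  The total variation of \<open>F\<close> is only ever used through the \<open>2 d\<close> Jordan parts of the coordinates of
  \<open>F\<close>, each a positive measure of mass at most \<open>P\<close>.
\<close>

section \<open>Jordan parts of a finite vector measure\<close>

lemma finite_vector_measure_Un:
  assumes "finite_vector_measure F" "A \<in> sets borel" "B \<in> sets borel" "A \<inter> B = {}"
  shows "F (A \<union> B) = F A + F B"
proof -
  have F0: "F {} = 0" and Fs: "\<And>A. range A \<subseteq> sets borel \<Longrightarrow> disjoint_family A \<Longrightarrow>
      (\<lambda>n. F (A n)) sums F (\<Union>n. A n)"
    using assms(1) by (auto simp: finite_vector_measure_def)
  have "(\<lambda>n. F (binaryset A B n)) sums F (\<Union>n. binaryset A B n)"
    by (rule Fs) (use assms in \<open>auto simp: range_binaryset_eq disjoint_family_on_def binaryset_def\<close>)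
  moreover have "(\<lambda>n. F (binaryset A B n)) sums (F A + F B)"
    by (rule binaryset_sums) (rule F0)
  ultimately show ?thesis
    by (simp add: UN_binaryset_eq sums_unique2)
qed

lemma norm_le_vector_total_variation:
  assumes "finite_vector_measure F" "B \<in> sets borel"
  shows "ennreal (norm (F B)) \<le> vector_total_variation F UNIV"
proof -
  have F0: "F {} = 0" using assms(1) by (auto simp: finite_vector_measure_def)
  have "ennreal (norm (F B)) \<le> ennreal (norm (F B)) + ennreal (norm (F (- B)))" by simp
  also have "\<dots> = (\<Sum>n. ennreal (norm (F (binaryset B (-B) n))))"
    by (rule suminf_binaryset_eq[symmetric]) (simp add: F0)
  also have "\<dots> \<le> vector_total_variation F UNIV"
    unfolding vector_total_variation_def
    by (rule SUP_upper)
       (use assms in \<open>auto simp: range_binaryset_eq disjoint_family_on_def binaryset_def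
          UN_binaryset_eq split: if_splits\<close>)
  finally show ?thesis .
qed

text \<open>
  The formula for \<open>\<nu>\<^sup>+\<close> is itself countably additive when \<open>\<nu>\<close> is: cutting a
  subset of \<open>\<Union>A\<^sub>n\<close> along the \<open>A\<^sub>n\<close> gives one inequality, and uniting subsets of finitely many
  \<open>A\<^sub>n\<close> gives the other. Only after this is known does
  \<^const>\<open>measure_of\<close> return the intended measure instead of the zero measure.
\<close>
lemma emeasure_jordan_pos:
  fixes F :: "'a::euclidean_space set \<Rightarrow> 'a"
  assumes F: "finite_vector_measure F" and A: "A \<in> sets borel"
  shows "emeasure (jordan_pos (\<lambda>A. F A \<bullet> v)) A = (SUP B\<in>{B \<in> sets borel. B \<subseteq> A}. ennreal (F B \<bullet> v))"
proof -
  define pos where "pos A = (SUP B\<in>{B \<in> sets borel. B \<subseteq> A}. ennreal (F B \<bullet> v))" for A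
  have F0: "F {} = 0" and Fs: "\<And>A. range A \<subseteq> sets borel \<Longrightarrow> disjoint_family A \<Longrightarrow>
      (\<lambda>n. F (A n)) sums F (\<Union>n. A n)"
    using F by (auto simp: finite_vector_measure_def)
  have pos_ge: "ennreal (F B \<bullet> v) \<le> pos A" if "B \<in> sets borel" "B \<subseteq> A" for A B
    unfolding pos_def by (rule SUP_upper) (use that in auto)
  have pos0: "pos {} = 0"
    unfolding pos_def using F0 by (auto simp: SUP_eq_iff intro!: antisym SUP_least)
  have pos_mono: "pos A \<le> pos B" if "A \<subseteq> B" for A B
    unfolding pos_def by (rule SUP_subset_mono) (use that in auto)
  have superadditive: "pos A + pos B \<le> pos (A \<union> B)" if AB: "A \<inter> B = {}" for A B
  proof -
    \<comment> \<open>The map \<^const>\<open>ennreal\<close> truncates negative values to \<open>0\<close>, which is the value of the empty subset.\<close>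
    have *: "ennreal (F A' \<bullet> v) + ennreal (F B' \<bullet> v) \<le> pos (A \<union> B)"
      if "A' \<in> sets borel" "A' \<subseteq> A" "B' \<in> sets borel" "B' \<subseteq> B" for A' B'
    proof -
      have 1: "ennreal (F A' \<bullet> v) \<le> pos (A \<union> B)" "ennreal (F B' \<bullet> v) \<le> pos (A \<union> B)"
        using that by (auto intro!: pos_ge)
      have "F (A' \<union> B') = F A' + F B'"
        by (rule finite_vector_measure_Un[OF F]) (use that AB in auto)
      then have 2: "ennreal (F A' \<bullet> v + F B' \<bullet> v) \<le> pos (A \<union> B)"
        using pos_ge[of "A' \<union> B'" "A \<union> B"] that by (auto simp: inner_add_left)
      show ?thesis
        using 1 2 by (cases "F A' \<bullet> v \<le> 0"; cases "F B' \<bullet> v \<le> 0") (auto simp: ennreal_neg)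
    qed
    show ?thesis
      unfolding pos_def[of A] pos_def[of B]
      apply (subst ennreal_SUP_add_left[symmetric])
       apply auto[1]
      apply (rule SUP_least)
      apply (subst add.commute)
      apply (subst ennreal_SUP_add_left[symmetric])
       apply auto[1]
      apply (rule SUP_least)
      apply (subst add.commute)
      apply (rule *)
         apply auto
      done
  qed
  have "countably_additive (sets borel) pos"
    unfolding countably_additive_def
  proof (intro allI impI)
    fix A :: "nat \<Rightarrow> 'a set"
    assume A: "range A \<subseteq> sets borel" "disjoint_family A"
    have "(\<Sum>i<n. pos (A i)) \<le> pos (\<Union>i<n. A i)" for n
    proof (induction n)
      case (Suc n)
      have "(\<Sum>i<Suc n. pos (A i)) \<le> pos (\<Union>i<n. A i) + pos (A n)"
        using Suc by (simp add: add_right_mono)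
      also have "\<dots> \<le> pos ((\<Union>i<n. A i) \<union> A n)"
      proof (rule superadditive)
        have "A i \<inter> A n = {}" if "i < n" for i
          using A(2) that by (simp add: disjoint_family_on_def)
        then show "(\<Union>i<n. A i) \<inter> A n = {}" by blast
      qed
      also have "\<dots> = pos (\<Union>i<Suc n. A i)"
        by (simp add: lessThan_Suc Un_commute)
      finally show ?case .
    qed (simp add: pos0)
    also have "\<And>n. pos (\<Union>i<n. A i) \<le> pos (\<Union>i. A i)" by (rule pos_mono) auto
    finally have "\<And>n. (\<Sum>i<n. pos (A i)) \<le> pos (\<Union>i. A i)" .
    then have le1: "(\<Sum>i. pos (A i)) \<le> pos (\<Union>i. A i)"
      by (intro suminf_le_const) auto
    have "ennreal (F B \<bullet> v) \<le> (\<Sum>i. pos (A i))" if B: "B \<in> sets borel" "B \<subseteq> (\<Union>i. A i)" for B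
    proof -
      have "(\<lambda>n. F (B \<inter> A n)) sums F (\<Union>n. B \<inter> A n)"
      proof (rule Fs)
        show "range (\<lambda>n. B \<inter> A n) \<subseteq> sets borel"
          using A(1) B(1) by (auto intro!: sets.Int)
        show "disjoint_family (\<lambda>n. B \<inter> A n)"
          using A(2) by (fastforce simp: disjoint_family_on_def)
      qed
      moreover have "(\<Union>n. B \<inter> A n) = B" using B by auto
      ultimately have "(\<lambda>n. F (B \<inter> A n) \<bullet> v) sums (F B \<bullet> v)"
        using bounded_linear.sums[OF bounded_linear_inner_left] by fastforce
      then have lim: "(\<lambda>n. ennreal (\<Sum>i<n. F (B \<inter> A i) \<bullet> v)) \<longlonglongrightarrow> ennreal (F B \<bullet> v)"
        unfolding sums_def by (rule tendsto_ennrealI)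
      have "ennreal (\<Sum>i<n. F (B \<inter> A i) \<bullet> v) \<le> (\<Sum>i. pos (A i))" for n
      proof -
        have "ennreal (\<Sum>i<n. F (B \<inter> A i) \<bullet> v) \<le> ennreal (\<Sum>i<n. max 0 (F (B \<inter> A i) \<bullet> v))"
          by (intro ennreal_leI sum_mono) auto
        also have "\<dots> = (\<Sum>i<n. ennreal (F (B \<inter> A i) \<bullet> v))"
          by (subst sum_ennreal[symmetric], simp, rule sum.cong[OF refl]) (simp add: max_def ennreal_neg)
        also have "\<dots> \<le> (\<Sum>i<n. pos (A i))"
          by (intro sum_mono pos_ge) (use A B in auto)
        also have "\<dots> \<le> (\<Sum>i. pos (A i))"
          by (rule sum_le_suminf) auto
        finally show ?thesis .
      qed
      then show ?thesis using lim by (intro LIMSEQ_le_const2[OF lim]) auto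
    qed
    then have "pos (\<Union>i. A i) \<le> (\<Sum>i. pos (A i))"
      unfolding pos_def[of "\<Union>i. A i"] by (intro SUP_least) auto
    with le1 show "(\<Sum>i. pos (A i)) = pos (\<Union>i. A i)" by (rule antisym)
  qed
  moreover have "positive (sets borel) pos"
    by (simp add: positive_def pos0)
  moreover have "sigma_algebra UNIV (sets (borel :: 'a measure))"
    by (metis sets.sigma_algebra_axioms space_borel)
  ultimately have "emeasure (measure_of UNIV (sets borel) pos) A = pos A"
    using A by (intro emeasure_measure_of_sigma)
  then show ?thesis unfolding jordan_pos_def pos_def .
qed

lemma sets_jordan_pos [simp, measurable_cong]:
  "sets (jordan_pos \<nu> :: 'a::euclidean_space measure) = sets borel"
  using sets.sigma_sets_eq[of "borel :: 'a measure"] by (simp add: jordan_pos_def sets_measure_of)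

lemma space_jordan_pos [simp]: "space (jordan_pos \<nu>) = UNIV"
  unfolding jordan_pos_def by (simp add: space_measure_of_conv)

lemma emeasure_jordan_pos_le:
  fixes F :: "'a::euclidean_space set \<Rightarrow> 'a"
  assumes F: "finite_vector_measure F" and v: "norm v \<le> 1"
  shows "emeasure (jordan_pos (\<lambda>A. F A \<bullet> v)) UNIV \<le> vector_total_variation F UNIV"
proof -
  have "ennreal (F B \<bullet> v) \<le> vector_total_variation F UNIV" if "B \<in> sets borel" for B
  proof -
    have "F B \<bullet> v \<le> norm (F B) * norm v" by (rule norm_cauchy_schwarz)
    also have "\<dots> \<le> norm (F B)" using v by (simp add: mult_left_le)
    finally show ?thesis
      using norm_le_vector_total_variation[OF F that] by (meson ennreal_leI order_trans)
  qed
  then show ?thesis by (subst emeasure_jordan_pos[OF F]) (auto intro!: SUP_least)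
qed

lemma finite_measure_jordan_pos:
  fixes F :: "'a::euclidean_space set \<Rightarrow> 'a"
  assumes F: "finite_vector_measure F" and v: "norm v \<le> 1"
  shows "finite_measure (jordan_pos (\<lambda>A. F A \<bullet> v))"
  using emeasure_jordan_pos_le[OF assms] F
  by (intro finite_measureI) (auto simp: finite_vector_measure_def top_unique)

section \<open>Functions of class C_k and smooth radial bumps\<close>

lemma C_k_SucD:
  assumes "C_k (Suc k) f"
  shows "(f has_derivative frechet_derivative f (at x)) (at x)"
    and "\<And>i. i \<in> Basis \<Longrightarrow> C_k k (\<lambda>x. frechet_derivative f (at x) i)"
  using assms by (auto simp: frechet_derivative_works[symmetric])

lemma C_k_SucI:
  assumes "\<And>x. (f has_derivative f' x) (at x)" "\<And>i. i \<in> Basis \<Longrightarrow> C_k k (\<lambda>x. f' x i)"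
  shows "C_k (Suc k) f"
proof -
  have "frechet_derivative f (at x) = f' x" for x
    using frechet_derivative_at[OF assms(1)] by metis
  then show ?thesis using assms by (auto simp: differentiable_def)
qed

lemma C_k_Suc_imp: "C_k (Suc k) f \<Longrightarrow> C_k k f"
proof (induction k arbitrary: f)
  case 0
  then show ?case
    by (auto intro!: differentiable_imp_continuous_on simp: differentiable_on_def
        intro: differentiable_at_withinI)
next
  case (Suc k)
  then show ?case
    by (metis C_k.simps(2))
qed

lemma C_k_const: "C_k k (\<lambda>x. c)"
proof (induction k arbitrary: c)
  case (Suc k)
  then show ?case by (intro C_k_SucI[where f' = "\<lambda>x y. 0"]) auto
qed simp

lemma C_k_inner: "C_k k (\<lambda>x. x \<bullet> v)"
proof (cases k)
  case (Suc k)
  show ?thesis unfolding Suc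
    by (rule C_k_SucI[where f' = "\<lambda>x y. y \<bullet> v"])
       (auto intro!: derivative_eq_intros C_k_const)
qed (auto intro!: continuous_intros)

lemma C_k_add: "C_k k f \<Longrightarrow> C_k k g \<Longrightarrow> C_k k (\<lambda>x. f x + g x)"
proof (induction k arbitrary: f g)
  case (Suc k)
  show ?case
    by (rule C_k_SucI[where f' = "\<lambda>x y. frechet_derivative f (at x) y + frechet_derivative g (at x) y"])
       (auto intro!: has_derivative_add C_k_SucD(1) Suc C_k_SucD(2))
qed (auto intro!: continuous_intros)

lemma C_k_mult: "C_k k f \<Longrightarrow> C_k k g \<Longrightarrow> C_k k (\<lambda>x. f x * g x)"
proof (induction k arbitrary: f g)
  case (Suc k)
  show ?case
    by (rule C_k_SucI[where f' = "\<lambda>x y. f x * frechet_derivative g (at x) y + frechet_derivative f (at x) y * g x"])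
       (auto intro!: has_derivative_mult C_k_SucD(1) C_k_add Suc.IH
          C_k_SucD(2)[OF Suc.prems(1)] C_k_SucD(2)[OF Suc.prems(2)]
          C_k_Suc_imp[OF Suc.prems(1)] C_k_Suc_imp[OF Suc.prems(2)] Suc.prems)
qed (auto intro!: continuous_intros)

lemma C_k_sum: "finite S \<Longrightarrow> (\<And>s. s \<in> S \<Longrightarrow> C_k k (f s)) \<Longrightarrow> C_k k (\<lambda>x. \<Sum>s\<in>S. f s x)"
  by (induction rule: finite_induct) (auto intro!: C_k_add C_k_const)

text \<open>
  The induction on \<open>k\<close> runs over all \<open>h\<close> and \<open>f\<close> at once, since the derivative of the composite is
  the product of \<open>h' \<circ> f\<close>, again a composite, with a derivative of \<open>f\<close>.
\<close>
lemma C_k_compose: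
  fixes h :: "real \<Rightarrow> real"
  shows "C_k k h \<Longrightarrow> C_k k f \<Longrightarrow> C_k k (\<lambda>x. h (f x))"
proof (induction k arbitrary: f h)
  case 0
  then show ?case by (auto intro: continuous_on_compose2)
next
  case (Suc k)
  note dh = C_k_SucD[OF Suc.prems(1)] and df = C_k_SucD[OF Suc.prems(2)]
  have lin: "frechet_derivative h (at u) t = frechet_derivative h (at u) 1 * t" for u t
    using linear_cmul[OF has_derivative_linear[OF dh(1)], of u t 1] by (simp add: mult.commute)
  show ?case
  proof (rule C_k_SucI[where f' = "\<lambda>x y. frechet_derivative h (at (f x)) 1 * frechet_derivative f (at x) y"])
    fix x
    have "((\<lambda>x. h (f x)) has_derivative
        (\<lambda>y. frechet_derivative h (at (f x)) (frechet_derivative f (at x) y))) (at x)"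
      by (rule has_derivative_compose[OF df(1) dh(1)])
    then show "((\<lambda>x. h (f x)) has_derivative
        (\<lambda>y. frechet_derivative h (at (f x)) 1 * frechet_derivative f (at x) y)) (at x)"
      by (subst (asm) lin)
  next
    fix i :: 'a assume i: "i \<in> Basis"
    show "C_k k (\<lambda>x. frechet_derivative h (at (f x)) 1 * frechet_derivative f (at x) i)"
      by (rule C_k_mult[OF Suc.IH[OF _ C_k_Suc_imp[OF Suc.prems(2)]] df(2)[OF i]])
         (use dh(2) in auto)
  qed
qed

text \<open>
  The case \<open>m = 0\<close> is the classical smooth function that vanishes exactly for \<open>t \<le> 0\<close>.
  The powers of \<open>1 / t\<close> are included because the family is then closed, up to linear combinations,
  under differentiation, which makes smoothness an induction.
\<close>
definition bump :: "nat \<Rightarrow> real \<Rightarrow> real" where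
  "bump m t = (if t > 0 then exp (- 1 / t) / t ^ m else 0)"

lemma bump_nonneg: "0 \<le> bump m t"
  by (auto simp: bump_def)

lemma bump_pos: "t > 0 \<Longrightarrow> 0 < bump m t"
  by (auto simp: bump_def)

lemma bump_nonpos_eq: "t \<le> 0 \<Longrightarrow> bump m t = 0"
  by (auto simp: bump_def)

text \<open>
  One term of the series of \<open>exp (1 / t)\<close> is at most its sum.
\<close>
lemma bump_le_fact: "bump m t \<le> fact m"
proof (cases "t > 0")
  case True
  have "(\<Sum>n\<in>{m}. (1 / t) ^ n /\<^sub>R fact n) \<le> exp (1 / t)"
    using True exp_converges[of "1 / t"] by (intro sums_le[OF _ sums_If_finite_set]) auto
  then have "(1 / t) ^ m / fact m \<le> exp (1 / t)"
    by (simp add: field_simps)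
  then show ?thesis using True
    by (simp add: bump_def field_simps exp_minus)
qed (auto simp: bump_def)

lemma bump_0_le_1: "bump 0 t \<le> 1"
  using bump_le_fact[of 0 t] by simp

text \<open>
  At \<open>0\<close> the difference quotient on the right is \<open>bump (m + 2) h * h\<close>, which tends to \<open>0\<close> because
  \<^term>\<open>bump (m + 2)\<close> is bounded.
\<close>
lemma bump_has_derivative:
  "(bump m has_real_derivative (bump (m + 2) t - real m * bump (m + 1) t)) (at t)"
proof -
  consider "t > 0" | "t < 0" | "t = 0" by linarith
  then show ?thesis
  proof cases
    case 1
    have "((\<lambda>t. exp (- 1 / t) / t ^ m) has_real_derivative
        (bump (m + 2) t - real m * bump (m + 1) t)) (at t)"
      using 1 by (auto intro!: derivative_eq_intros simp: bump_def field_simps power2_eq_square)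
        (cases m; simp add: field_simps)
    then show ?thesis
      by (rule has_field_derivative_transform_within_open[of _ _ _ "{0<..}"])
         (use 1 in \<open>auto simp: bump_def\<close>)
  next
    case 2
    have "((\<lambda>t. 0) has_real_derivative (bump (m + 2) t - real m * bump (m + 1) t)) (at t)"
      using 2 by (auto simp: bump_def)
    then show ?thesis
      by (rule has_field_derivative_transform_within_open[of _ _ _ "{..<0}"])
         (use 2 in \<open>auto simp: bump_def\<close>)
  next
    case 3
    have "((\<lambda>h. bump m h / h) \<longlongrightarrow> 0) (at 0)"
    proof (rule Lim_null_comparison)
      have "norm (bump m h / h) \<le> fact (m + 2) * \<bar>h\<bar>" for h
      proof (cases "h > 0")
        case True
        have "bump m h / h = bump (m + 2) h * h"
          using True by (simp add: bump_def field_simps)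
        then show ?thesis
          using True bump_le_fact[of "m + 2" h] bump_nonneg[of "m + 2" h]
          by (simp add: abs_mult mult_right_mono)
      next
        case False
        then have "norm (bump m h / h) = 0" by (simp add: bump_def)
        also have "0 \<le> fact (m + 2) * \<bar>h\<bar>" by (intro mult_nonneg_nonneg) auto
        finally show ?thesis .
      qed
      then show "\<forall>\<^sub>F h in at 0. norm (bump m h / h) \<le> fact (m + 2) * \<bar>h\<bar>" by simp
      show "((\<lambda>h::real. fact (m + 2) * \<bar>h\<bar>) \<longlongrightarrow> 0) (at 0)"
        by (intro tendsto_eq_intros) auto
    qed
    then show ?thesis using 3 by (simp add: DERIV_def bump_def)
  qed
qed

lemma bump_C_k: "C_k k (bump m)"
proof (induction k arbitrary: m)
  case 0
  show ?case
    by (auto simp: continuous_on_eq_continuous_at intro: DERIV_isCont[OF bump_has_derivative])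
next
  case (Suc k)
  show ?case
  proof (rule C_k_SucI[where f' = "\<lambda>t h. (bump (m + 2) t - real m * bump (m + 1) t) * h"])
    show "(bump m has_derivative (\<lambda>h. (bump (m + 2) t - real m * bump (m + 1) t) * h)) (at t)" for t
      using bump_has_derivative[of m t] by (simp add: has_field_derivative_def)
    have "C_k k (\<lambda>t. bump (m + 2) t + (- real m) * bump (m + 1) t)"
      by (intro C_k_add C_k_mult C_k_const Suc)
    then show "C_k k (\<lambda>t. (bump (m + 2) t - real m * bump (m + 1) t) * i)" if "i \<in> Basis" for i :: real
      using that by simp
  qed
qed

text \<open>
  The unnormalised standard mollifier at scale \<open>s\<close> around \<open>x\<close>, a smooth function supported in the
  ball of radius \<open>s\<close>. As a function of \<open>s\<close> it depends on \<open>norm (x - y) / s\<close> only; this homogeneity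
  is what lets an integral over \<open>s\<close> produce a power of \<open>norm (x - y)\<close>.
\<close>
definition radial_bump :: "'a::euclidean_space \<Rightarrow> real \<Rightarrow> 'a \<Rightarrow> real" where
  "radial_bump x s y = bump 0 (1 - (norm (x - y) / s)\<^sup>2)"

lemma radial_bump_nonneg: "0 \<le> radial_bump x s y"
  by (simp add: radial_bump_def bump_nonneg)

lemma radial_bump_le_indicator: "s > 0 \<Longrightarrow> radial_bump x s y \<le> indicator (cball x s) y"
proof (cases "y \<in> cball x s")
  case False
  assume "s > 0"
  then have "1 \<le> norm (x - y) / s" using False by (simp add: dist_norm)
  then have "1 \<le> (norm (x - y) / s)\<^sup>2" by simp
  then show ?thesis using False by (simp add: radial_bump_def bump_nonpos_eq)
qed (simp add: radial_bump_def bump_0_le_1)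

lemma test_function_radial_bump:
  assumes s: "s > 0"
  shows "test_function (radial_bump x s)"
  unfolding test_function_def
proof (intro conjI allI)
  fix k
  have lin: "C_k k (\<lambda>y. y \<bullet> i + - (x \<bullet> i))" for i
    by (rule C_k_add[OF C_k_inner C_k_const])
  have quad: "C_k k (\<lambda>y. \<Sum>i\<in>Basis. (y \<bullet> i + - (x \<bullet> i)) * (y \<bullet> i + - (x \<bullet> i)))"
    by (rule C_k_sum[OF finite_Basis C_k_mult[OF lin lin]])
  have "C_k k (\<lambda>y. bump 0 (1 + (- 1 / s\<^sup>2) * (\<Sum>i\<in>Basis. (y \<bullet> i + - (x \<bullet> i)) * (y \<bullet> i + - (x \<bullet> i)))))"
    by (rule C_k_compose[OF bump_C_k C_k_add[OF C_k_const C_k_mult[OF C_k_const quad]]])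
  moreover have "(norm (x - y))\<^sup>2 = (\<Sum>i\<in>Basis. (y \<bullet> i + - (x \<bullet> i)) * (y \<bullet> i + - (x \<bullet> i)))" for y
    unfolding norm_minus_commute[of x y] power2_norm_eq_inner
    by (subst euclidean_inner) (simp add: inner_diff_left)
  ultimately show "C_k k (radial_bump x s)"
    by (simp add: radial_bump_def[abs_def] power_divide)
next
  have "{y. radial_bump x s y \<noteq> 0} \<subseteq> cball x s"
  proof
    fix y assume "y \<in> {y. radial_bump x s y \<noteq> 0}"
    then show "y \<in> cball x s"
      using radial_bump_le_indicator[OF s, of x y] radial_bump_nonneg[of x s y]
      by (cases "y \<in> cball x s") auto
  qed
  then have "closure {y. radial_bump x s y \<noteq> 0} \<subseteq> cball x s"
    by (simp add: closure_minimal)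
  then show "compact (closure {y. radial_bump x s y \<noteq> 0})"
    by (metis bounded_cball bounded_subset closed_closure compact_eq_bounded_closed)
qed

text \<open>
  The factor \<open>1 / s\<close> is the gain that balances the perimeter against the volume: testing \<open>D\<chi>\<^sub>E\<close>
  with a bump costs its mass in the ball, while integrating by parts costs the volume of \<open>E\<close> in the
  ball divided by \<open>s\<close>.
\<close>
lemma norm_grad_radial_bump_le:
  fixes x :: "'a::euclidean_space"
  assumes s: "s > 0"
  shows "norm (grad (radial_bump x s) y) \<le> 4 / s * indicator (cball x s) y"
proof -
  define u where "u = 1 - (norm (x - y) / s)\<^sup>2"
  have "((\<lambda>y. 1 - (norm (x - y) / s)\<^sup>2) has_derivative (\<lambda>h. 2 / s\<^sup>2 * ((x - y) \<bullet> h))) (at y)"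
    unfolding power_divide power2_norm_eq_inner
    using s by (auto intro!: derivative_eq_intros simp: inner_commute field_simps fun_eq_iff)
  moreover have "(bump 0 has_derivative (\<lambda>h. bump 2 u * h)) (at u)"
    using bump_has_derivative[of 0 u] by (simp add: has_field_derivative_def numeral_2_eq_2)
  ultimately have "(radial_bump x s has_derivative (\<lambda>h. bump 2 u * (2 / s\<^sup>2 * ((x - y) \<bullet> h)))) (at y)"
    unfolding radial_bump_def[abs_def] u_def by (rule has_derivative_compose)
  then have "frechet_derivative (radial_bump x s) (at y) = (\<lambda>h. bump 2 u * (2 / s\<^sup>2 * ((x - y) \<bullet> h)))"
    using frechet_derivative_at by metis
  then have "grad (radial_bump x s) y = (\<Sum>i\<in>Basis. (bump 2 u * 2 / s\<^sup>2) *\<^sub>R (((x - y) \<bullet> i) *\<^sub>R i))"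
    unfolding grad_def by (simp add: mult.assoc)
  also have "\<dots> = (bump 2 u * 2 / s\<^sup>2) *\<^sub>R (x - y)"
    by (simp only: scaleR_sum_right[symmetric] euclidean_representation)
  finally have n: "norm (grad (radial_bump x s) y) = bump 2 u * 2 / s\<^sup>2 * norm (x - y)"
    by (simp add: bump_nonneg)
  show ?thesis
  proof (cases "y \<in> cball x s")
    case True
    have "bump 2 u * 2 / s\<^sup>2 * norm (x - y) \<le> 2 * 2 / s\<^sup>2 * s"
      using True s bump_le_fact[of 2 u] bump_nonneg[of 2 u]
      by (intro mult_mono divide_right_mono) (auto simp: dist_norm fact_2)
    then show ?thesis using n True s by (simp add: power2_eq_square)
  next
    case False
    then have "1 \<le> norm (x - y) / s" using s by (simp add: dist_norm)
    then have "1 \<le> (norm (x - y) / s)\<^sup>2" by simp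
    then show ?thesis using False n by (simp add: u_def bump_nonpos_eq)
  qed
qed

section \<open>Integrals dominated by two powers\<close>

text \<open>
  This is the optimisation step, used twice: for the integral over the scales \<open>s\<close> of the bumps and
  for the integral over the levels \<open>t\<close> in the Lorentz quasi-norm.
\<close>
lemma nn_integral_le_two_powers:
  fixes f :: "real \<Rightarrow> ennreal"
  assumes p: "p > -1" and q: "q < -1" and r: "r > 0" and A: "A \<ge> 0" and B: "B \<ge> 0"
    and near: "\<And>s. 0 < s \<Longrightarrow> s \<le> r \<Longrightarrow> f s \<le> ennreal (A * s powr p)"
    and far: "\<And>s. r \<le> s \<Longrightarrow> f s \<le> ennreal (B * s powr q)"
  shows "(\<integral>\<^sup>+s\<in>{0<..}. f s \<partial>lborel)
    \<le> ennreal (A * (r powr (p + 1) / (p + 1)) + B * (- (r powr (q + 1)) / (q + 1)))"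
proof -
  have 1: "(\<integral>\<^sup>+s. ennreal (indicator {0..r} s * (A * s powr p)) \<partial>lborel)
      = ennreal (A * (r powr (p + 1) / (p + 1)))"
    by (rule nn_integral_has_integral_lebesgue[OF _ has_integral_mult_right[OF has_integral_powr_from_0]])
       (use p r A in auto)
  have 2: "(\<integral>\<^sup>+s. ennreal (indicator {r..} s * (B * s powr q)) \<partial>lborel)
      = ennreal (B * (- (r powr (q + 1)) / (q + 1)))"
    by (rule nn_integral_has_integral_lebesgue[OF _ has_integral_mult_right[OF has_integral_powr_to_inf]])
       (use q r B in auto)
  have "(\<integral>\<^sup>+s\<in>{0<..}. f s \<partial>lborel) \<le> (\<integral>\<^sup>+s. ennreal (indicator {0..r} s * (A * s powr p))
      + ennreal (indicator {r..} s * (B * s powr q)) \<partial>lborel)"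
  proof (rule nn_integral_mono)
    fix s :: real
    show "f s * indicator {0<..} s \<le> ennreal (indicator {0..r} s * (A * s powr p))
      + ennreal (indicator {r..} s * (B * s powr q))"
    proof (cases "s > 0")
      case True
      show ?thesis
      proof (cases "s \<le> r")
        case sr: True
        then have "f s * indicator {0<..} s \<le> ennreal (indicator {0..r} s * (A * s powr p))"
          using near[OF True] True by auto
        then show ?thesis by (rule add_increasing2[rotated]) simp
      next
        case False
        then show ?thesis using far[of s] True by auto
      qed
    qed auto
  qed
  also have "\<dots> = ennreal (A * (r powr (p + 1) / (p + 1))) + ennreal (B * (- (r powr (q + 1)) / (q + 1)))"
    by (subst nn_integral_add) (simp_all add: 1 2)
  also have "\<dots> = ennreal (A * (r powr (p + 1) / (p + 1)) + B * (- (r powr (q + 1)) / (q + 1)))"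
    using A B p q r
    by (intro ennreal_plus[symmetric] mult_nonneg_nonneg divide_nonneg_pos divide_nonpos_neg) auto
  finally show ?thesis .
qed

lemma integral_le_two_powers:
  fixes f :: "real \<Rightarrow> 'b::{banach, second_countable_topology}"
  assumes p: "p > -1" and q: "q < -1" and r: "r > 0" and A: "A \<ge> 0" and B: "B \<ge> 0"
    and f: "f \<in> borel_measurable borel" and f0: "\<And>s. s \<le> 0 \<Longrightarrow> f s = 0"
    and near: "\<And>s. 0 < s \<Longrightarrow> s \<le> r \<Longrightarrow> norm (f s) \<le> A * s powr p"
    and far: "\<And>s. r \<le> s \<Longrightarrow> norm (f s) \<le> B * s powr q"
  shows "integrable lborel f"
    and "norm (LBINT s. f s) \<le> A * (r powr (p + 1) / (p + 1)) + B * (- (r powr (q + 1)) / (q + 1))"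
proof -
  have "(\<integral>\<^sup>+s. norm (f s) \<partial>lborel) = (\<integral>\<^sup>+s\<in>{0<..}. norm (f s) \<partial>lborel)"
    by (rule nn_integral_cong) (use f0 in \<open>auto simp: indicator_def not_less\<close>)
  also have "\<dots> \<le> ennreal (A * (r powr (p + 1) / (p + 1)) + B * (- (r powr (q + 1)) / (q + 1)))"
    by (rule nn_integral_le_two_powers) (use assms in \<open>auto intro!: ennreal_leI\<close>)
  finally have le: "(\<integral>\<^sup>+s. norm (f s) \<partial>lborel)
      \<le> ennreal (A * (r powr (p + 1) / (p + 1)) + B * (- (r powr (q + 1)) / (q + 1)))" .
  show int: "integrable lborel f"
    by (rule integrableI_bounded) (use f le in \<open>auto intro: le_less_trans\<close>)
  have "0 \<le> A * (r powr (p + 1) / (p + 1)) + B * (- (r powr (q + 1)) / (q + 1))"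
    using A B p q r
    by (intro add_nonneg_nonneg mult_nonneg_nonneg divide_nonneg_pos divide_nonpos_neg) auto
  then show "norm (LBINT s. f s) \<le> A * (r powr (p + 1) / (p + 1)) + B * (- (r powr (q + 1)) / (q + 1))"
    using order_trans[OF integral_norm_bound_ennreal[OF int] le] by simp
qed

section \<open>Maximal function\<close>

text \<open>
  The weak type \<open>(1,1)\<close> bound for the centred maximal function of \<open>M\<close>. By Vitali's lemma the bad
  points lie in the fivefold enlargements of countably many disjoint bad balls, and the volumes of
  disjoint bad balls add up to at most a multiple of the total mass over \<open>a\<close>. The union
  of the enlarged balls is the set \<open>U\<close>.
\<close>
lemma large_balls_covered:
  fixes M :: "'a::euclidean_space measure"
  assumes sets: "sets borel \<subseteq> sets M" and m: "emeasure M (space M) \<le> ennreal m" "m \<ge> 0" and a: "a > 0"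
  obtains U where "U \<in> sets borel"
    "{x. \<exists>s>0. ennreal (a * s ^ DIM('a)) < emeasure M (cball x s)} \<subseteq> U"
    "emeasure lborel U \<le> ennreal (unit_ball_vol (real DIM('a)) * 5 ^ DIM('a) * m / a)"
proof -
  define K where "K = {(x::'a, s). s > 0 \<and> ennreal (a * s ^ DIM('a)) < emeasure M (cball x s)}"
  \<comment> \<open>Vitali's lemma needs bounded radii; here \<open>s \<le> s ^ d < m / a\<close> as soon as \<open>s \<ge> 1\<close>.\<close>
  have rad: "0 < snd i \<and> snd i \<le> 1 + m / a" if "i \<in> K" for i
  proof -
    obtain x s where i: "i = (x, s)" by fastforce
    have s: "s > 0" "ennreal (a * s ^ DIM('a)) < emeasure M (cball x s)"
      using that by (auto simp: K_def i)
    have "emeasure M (cball x s) \<le> ennreal m"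
      using m(1) emeasure_space[of M "cball x s"] by (rule order_trans[rotated])
    with s(2) have "ennreal (a * s ^ DIM('a)) < ennreal m" by (rule less_le_trans)
    then have "a * s ^ DIM('a) < m" using a s by (simp add: ennreal_less_iff)
    then have sd: "s ^ DIM('a) < m / a" using a by (simp add: field_simps)
    have "s \<le> 1 + m / a"
    proof (cases "s \<ge> 1")
      case True
      then have "s ^ 1 \<le> s ^ DIM('a)" by (intro power_increasing) auto
      then show ?thesis using sd by simp
    next
      case False
      moreover have "0 \<le> m / a" using m a by simp
      ultimately show ?thesis by linarith
    qed
    then show ?thesis using s by (simp add: i)
  qed
  have cov: "{x. \<exists>s>0. ennreal (a * s ^ DIM('a)) < emeasure M (cball x s)}
      \<subseteq> (\<Union>i\<in>K. cball (fst i) (snd i))"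
    by (force simp: K_def)
  obtain C where C: "countable C" "C \<subseteq> K"
     "pairwise (\<lambda>i j. disjnt (cball (fst i) (snd i)) (cball (fst j) (snd j))) C"
     "{x. \<exists>s>0. ennreal (a * s ^ DIM('a)) < emeasure M (cball x s)} \<subseteq> (\<Union>i\<in>C. cball (fst i) (5 * snd i))"
    by (rule Vitali_covering_lemma_cballs[OF cov rad])
  define J where "J = to_nat_on C ` C"
  define X where "X t n = (if n \<in> J then cball (fst (from_nat_into C n)) (t * snd (from_nat_into C n)) else {})"
    for t n
  have idx: "from_nat_into C n \<in> C" if "n \<in> J" for n
    using that C(1) by (auto simp: J_def)
  have idx_inj: "from_nat_into C n \<noteq> from_nat_into C k" if "n \<in> J" "k \<in> J" "n \<noteq> k" for n k
    using that C(1) by (auto simp: J_def)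
  have X_sets: "X t n \<in> sets borel" for t n by (simp add: X_def)
  define U where "U = (\<Union>n. X 5 n)"
  have CU: "(\<Union>i\<in>C. cball (fst i) (5 * snd i)) \<subseteq> U"
  proof safe
    fix x y s assume "(y, s) \<in> C" "x \<in> cball (fst (y, s)) (5 * snd (y, s))"
    then have "x \<in> X 5 (to_nat_on C (y, s))" using C(1) by (simp add: X_def J_def)
    then show "x \<in> U" by (auto simp: U_def)
  qed
  have disj: "disjoint_family (X 1)"
    using C(3) idx idx_inj by (auto simp: disjoint_family_on_def X_def pairwise_def disjnt_def)
  define c where "c = unit_ball_vol (real DIM('a)) * 5 ^ DIM('a) / a"
  have c: "c \<ge> 0" using a by (simp add: c_def)
  have X5: "emeasure lborel (X 5 n) \<le> ennreal c * emeasure M (X 1 n)" for n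
  proof (cases "n \<in> J")
    case True
    obtain x s where i: "from_nat_into C n = (x, s)" by fastforce
    have "(x, s) \<in> K" using idx[OF True] C(2) i by auto
    then have s: "s > 0" "ennreal (a * s ^ DIM('a)) \<le> emeasure M (cball x s)"
      by (auto simp: K_def less_imp_le)
    have "emeasure lborel (X 5 n) = ennreal (unit_ball_vol (real DIM('a)) * (5 * s) ^ DIM('a))"
      using True i s by (simp add: X_def emeasure_cball)
    also have "unit_ball_vol (real DIM('a)) * (5 * s) ^ DIM('a) = c * (a * s ^ DIM('a))"
      using a by (simp add: c_def power_mult_distrib)
    also have "ennreal \<dots> = ennreal c * ennreal (a * s ^ DIM('a))"
      using a c s by (intro ennreal_mult) auto
    also have "\<dots> \<le> ennreal c * emeasure M (X 1 n)"
      using s True i by (intro mult_left_mono) (auto simp: X_def)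
    finally show ?thesis .
  qed (simp add: X_def)
  have "emeasure lborel U \<le> (\<Sum>n. emeasure lborel (X 5 n))"
    unfolding U_def by (rule emeasure_subadditive_countably) (use X_sets in auto)
  also have "\<dots> \<le> (\<Sum>n. ennreal c * emeasure M (X 1 n))"
    by (intro suminf_le X5) auto
  also have "\<dots> = ennreal c * emeasure M (\<Union>n. X 1 n)"
    using X_sets sets disj by (subst suminf_emeasure[symmetric]) (auto intro!: ennreal_suminf_cmult)
  also have "\<dots> \<le> ennreal c * ennreal m"
    by (intro mult_left_mono order_trans[OF emeasure_space m(1)]) auto
  also have "\<dots> = ennreal (unit_ball_vol (real DIM('a)) * 5 ^ DIM('a) * m / a)"
    using c m by (simp add: ennreal_mult[symmetric] c_def)
  finally show ?thesis
    using that[OF _ order_trans[OF C(4) CU]] X_sets by (auto simp: U_def)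
qed

section \<open>The Riesz kernel as a superposition of bumps\<close>

lemma bump_measurable [measurable]: "bump m \<in> borel_measurable borel"
  unfolding bump_def[abs_def] by measurable

lemma bump_0_mono: "0 < u \<Longrightarrow> u \<le> v \<Longrightarrow> bump 0 u \<le> bump 0 v"
  by (simp add: bump_def frac_le)

text \<open>
  The density of \<open>s powr (- e - 1) ds\<close> on the positive half-line. Superposing the bumps
  \<^term>\<open>radial_bump x s\<close> with this weight gives a multiple of the kernel \<open>1 / norm (x - y) powr e\<close>;
  the constant is \<open>bump_moment e\<close>.
\<close>
definition scale_weight :: "real \<Rightarrow> real \<Rightarrow> real" where
  "scale_weight e s = indicator {0<..} s * s powr (- e - 1)"

definition bump_moment :: "real \<Rightarrow> real" where
  "bump_moment e = (LBINT s. scale_weight e s * bump 0 (1 - (1 / s)\<^sup>2))"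

lemma scale_weight_measurable [measurable]: "scale_weight e \<in> borel_measurable borel"
  unfolding scale_weight_def[abs_def] by measurable

lemma scale_weight_nonneg: "0 \<le> scale_weight e s"
  by (simp add: scale_weight_def)

lemma scale_weight_scale: "c > 0 \<Longrightarrow> scale_weight e (c * s) = c powr (- e - 1) * scale_weight e s"
  by (auto simp: scale_weight_def indicator_def powr_mult zero_less_mult_iff)

text \<open>
  Substitute \<open>s = norm (x - y) * s'\<close>. At \<open>y = x\<close> both sides are \<open>0\<close> by convention: the integral
  diverges, and the kernel is \<open>1 / 0\<close>.
\<close>
lemma integral_scale_weight_bump:
  fixes x y :: "'a::euclidean_space"
  assumes e: "e > 0"
  shows "(LBINT s. scale_weight e s * radial_bump x s y) = bump_moment e * (1 / norm (x - y) powr e)"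
proof (cases "x = y")
  case True
  define I where "I = (LBINT s. scale_weight e s * bump 0 1)"
  \<comment> \<open>Scaling by \<open>2\<close> multiplies \<open>I\<close> by \<open>2 powr (- e) \<noteq> 1\<close>, so the value of the integral must be \<open>0\<close>.\<close>
  have "I = \<bar>2\<bar> *\<^sub>R (LBINT s. scale_weight e (0 + 2 * s) * bump 0 1)"
    unfolding I_def by (rule lborel_integral_real_affine) simp
  also have "\<dots> = 2 * 2 powr (- e - 1) * I"
    by (simp add: scale_weight_scale I_def mult.assoc)
  also have "2 * 2 powr (- e - 1) = 2 powr (- e)"
    by (simp add: powr_diff)
  finally have "(1 - 2 powr (- e)) * I = 0" by (simp add: algebra_simps)
  moreover have "2 powr (- e) < 2 powr (0::real)" using e by (intro powr_less_mono) auto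
  ultimately have "I = 0" using e by simp
  then show ?thesis using True by (simp add: I_def radial_bump_def)
next
  case False
  define z where "z = norm (x - y)"
  have z: "z > 0" using False by (simp add: z_def)
  have "(LBINT s. scale_weight e s * radial_bump x s y)
      = \<bar>z\<bar> *\<^sub>R (LBINT s. scale_weight e (0 + z * s) * radial_bump x (0 + z * s) y)"
    by (rule lborel_integral_real_affine) (use z in simp)
  also have "(LBINT s. scale_weight e (0 + z * s) * radial_bump x (0 + z * s) y)
      = (LBINT s. z powr (- e - 1) * (scale_weight e s * bump 0 (1 - (1 / s)\<^sup>2)))"
    using z by (intro Bochner_Integration.integral_cong)
      (auto simp: scale_weight_scale radial_bump_def z_def[symmetric] mult.assoc)
  also have "\<dots> = z powr (- e - 1) * bump_moment e"
    by (simp add: bump_moment_def)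
  finally show ?thesis
    using z by (simp add: z_def[symmetric] powr_diff powr_minus field_simps)
qed

text \<open>
  The integrand vanishes for \<open>s \<le> 1\<close>, is at most \<open>s powr (- e - 1)\<close> beyond, and is bounded away
  from \<open>0\<close> on \<open>{2..3}\<close>.
\<close>
lemma bump_moment_pos:
  assumes e: "e > 0"
  shows "bump_moment e > 0"
proof -
  let ?f = "\<lambda>s. scale_weight e s * bump 0 (1 - (1 / s)\<^sup>2)"
  define c where "c = 3 powr (- e - 1) * bump 0 (3 / 4)"
  have c: "c > 0" by (auto simp: c_def bump_pos)
  have int: "integrable lborel ?f"
  proof (rule integral_le_two_powers(1)[where p = 0 and q = "- e - 1" and r = 1 and A = 0 and B = 1])
    show "norm (?f s) \<le> 0 * s powr 0" if "0 < s" "s \<le> 1" for s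
      using that by (simp add: bump_nonpos_eq)
    show "norm (?f s) \<le> 1 * s powr (- e - 1)" if "1 \<le> s" for s
      using that by (auto simp: scale_weight_def abs_mult bump_nonneg bump_0_le_1 intro!: mult_left_le)
  qed (use e in \<open>auto simp: scale_weight_def\<close>)
  have le: "c * indicator {2..3} s \<le> ?f s" for s
  proof (cases "s \<in> {2..3}")
    case True
    have "bump 0 (3 / 4) \<le> bump 0 (1 - (1 / s)\<^sup>2)"
    proof -
      have "(1 / s)\<^sup>2 \<le> (1 / 2)\<^sup>2"
        using True by (intro power_mono) (auto simp: field_simps)
      then have "3 / 4 \<le> 1 - (1 / s)\<^sup>2" by (simp add: power2_eq_square)
      then show ?thesis using bump_0_mono[of "3 / 4"] by simp
    qed
    moreover have "3 powr (- e - 1) \<le> s powr (- e - 1)"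
      using True e by (intro powr_mono2') auto
    ultimately show ?thesis using True
      by (auto simp: c_def scale_weight_def bump_nonneg intro!: mult_mono)
  qed (auto simp: scale_weight_nonneg bump_nonneg)
  have "c = (LBINT s. c * indicator {2..3::real} s)" by simp
  also have "\<dots> \<le> bump_moment e"
    unfolding bump_moment_def by (rule integral_mono[OF _ int le]) auto
  finally show ?thesis using c by simp
qed

lemma radial_bump_measurable [measurable]:
  "(\<lambda>(s, y). radial_bump x s y) \<in> borel_measurable (borel \<Otimes>\<^sub>M borel)"
  unfolding radial_bump_def by measurable

lemma integral_radial_bump_le:
  fixes N :: "'a::euclidean_space measure"
  assumes N: "finite_measure N" "sets N = sets borel" and s: "s > 0"
  shows "integrable N (radial_bump x s)"
    and "(LINT y|N. radial_bump x s y) \<le> measure N (cball x s)"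
proof -
  interpret finite_measure N by fact
  note [measurable_cong] = N(2)
  show int: "integrable N (radial_bump x s)"
    by (rule integrable_const_bound[where B = 1])
       (auto simp: radial_bump_def bump_nonneg bump_0_le_1)
  have "(LINT y|N. radial_bump x s y) \<le> (LINT y|N. indicator (cball x s) y)"
    by (rule integral_mono[OF int _ radial_bump_le_indicator[OF s]])
       (simp add: N(2) integrable_indicator_iff less_top[symmetric])
  then show "(LINT y|N. radial_bump x s y) \<le> measure N (cball x s)"
    using sets_eq_imp_space_eq[OF N(2)] by simp
qed

text \<open>
  The exchange of the two integrals is where finiteness of the maximal function at \<open>x\<close> enters: it
  controls the small scales, the total mass of \<open>N\<close> controls the large ones. In particular
  the potential converges at every such \<open>x\<close>.
\<close>
lemma integral_riesz_kernel:
  fixes N :: "'a::euclidean_space measure"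
  assumes N: "finite_measure N" "sets N = sets borel"
    and e: "real DIM('a) - 1 < e" "e < real DIM('a)"  and a: "a \<ge> 0"
    and balls: "\<And>s. s > 0 \<Longrightarrow> measure N (cball x s) \<le> a * s ^ DIM('a)"
  shows "integrable lborel (\<lambda>s. scale_weight e s * (LINT y|N. radial_bump x s y))"
    and "(LINT y|N. 1 / norm (x - y) powr e)
      = (LBINT s. scale_weight e s * (LINT y|N. radial_bump x s y)) / bump_moment e"
proof -
  interpret N: finite_measure N by fact
  interpret P: pair_sigma_finite lborel N ..
  note [measurable_cong] = N(2)
  have e0: "e > 0" using e DIM_positive[where 'a='a] by linarith
  have nonneg: "0 \<le> (LINT y|N. radial_bump x s y)" for s
    by (simp add: radial_bump_nonneg)
  show int: "integrable lborel (\<lambda>s. scale_weight e s * (LINT y|N. radial_bump x s y))"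
  proof (rule integral_le_two_powers(1)[where p = "real DIM('a) - e - 1" and q = "- e - 1" and r = 1
        and A = a and B = "measure N (space N)"])
    fix s :: real assume "0 < s" "s \<le> 1"
    then have "scale_weight e s * (LINT y|N. radial_bump x s y) \<le> s powr (- e - 1) * (a * s ^ DIM('a))"
      using integral_radial_bump_le(2)[OF N, of s x] balls[of s]
      by (intro mult_mono) (auto simp: scale_weight_def nonneg)
    also have "s powr (- e - 1) * (a * s ^ DIM('a)) = a * s powr (real DIM('a) - e - 1)"
      using \<open>0 < s\<close> by (simp add: powr_realpow[symmetric] powr_add[symmetric] algebra_simps)
    finally show "norm (scale_weight e s * (LINT y|N. radial_bump x s y)) \<le> a * s powr (real DIM('a) - e - 1)"
      by (simp add: scale_weight_nonneg nonneg)
  next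
    fix s :: real assume "1 \<le> s"
    then have "scale_weight e s * (LINT y|N. radial_bump x s y) \<le> s powr (- e - 1) * measure N (space N)"
      using integral_radial_bump_le(2)[OF N, of s x] N.bounded_measure[of "cball x s"]
      by (intro mult_mono) (auto simp: scale_weight_def nonneg)
    then show "norm (scale_weight e s * (LINT y|N. radial_bump x s y)) \<le> measure N (space N) * s powr (- e - 1)"
      by (simp add: scale_weight_nonneg nonneg mult.commute)
  qed (use e e0 a in \<open>auto simp: scale_weight_def\<close>)
  have "integrable (lborel \<Otimes>\<^sub>M N) (\<lambda>(s, y). scale_weight e s * radial_bump x s y)"
  proof (rule P.Fubini_integrable)
    have "(LINT y|N. norm (scale_weight e s * radial_bump x s y))
        = scale_weight e s * (LINT y|N. radial_bump x s y)" for s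
      by (simp add: abs_mult scale_weight_nonneg radial_bump_nonneg)
    then show "integrable lborel (\<lambda>s. LINT y|N. norm (case (s, y) of (s, y) \<Rightarrow> scale_weight e s * radial_bump x s y))"
      using int by simp
    have "integrable N (\<lambda>y. scale_weight e s * radial_bump x s y)" for s
      using integral_radial_bump_le(1)[OF N, of s x] by (cases "s > 0") (auto simp: scale_weight_def)
    then show "AE s in lborel. integrable N (\<lambda>y. case (s, y) of (s, y) \<Rightarrow> scale_weight e s * radial_bump x s y)"
      by simp
  qed measurable
  then have "(LINT y|N. (LBINT s. scale_weight e s * radial_bump x s y))
      = (LBINT s. (LINT y|N. scale_weight e s * radial_bump x s y))"
    by (rule P.Fubini_integral)
  then show "(LINT y|N. 1 / norm (x - y) powr e)
      = (LBINT s. scale_weight e s * (LINT y|N. radial_bump x s y)) / bump_moment e"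
    using bump_moment_pos[OF e0]
    by (simp add: integral_scale_weight_bump[OF e0] field_simps del: times_divide_eq_right)
qed

section \<open>The pointwise bound\<close>

abbreviation jordan_part :: "('a::euclidean_space set \<Rightarrow> 'a) \<Rightarrow> 'a \<Rightarrow> 'a measure" where
  "jordan_part F v \<equiv> jordan_pos (\<lambda>A. F A \<bullet> v)"

lemma vector_integral_jordan_parts:
  "vector_integral F f =
     (\<Sum>i\<in>Basis. ((LINT y|jordan_part F i. f y) - (LINT y|jordan_part F (- i). f y)) *\<^sub>R i)"
  by (simp add: vector_integral_def signed_integral_def)

lemma norm_vector_integral_bump_le_mass:
  fixes F :: "'a::euclidean_space set \<Rightarrow> 'a"
  assumes F: "finite_vector_measure F" and s: "s > 0"
    and balls: "\<And>v. v \<in> Basis \<union> uminus ` Basis \<Longrightarrow> measure (jordan_part F v) (cball x s) \<le> c"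
  shows "norm (vector_integral F (radial_bump x s)) \<le> 2 * real DIM('a) * c"
proof -
  have le: "(LINT y|jordan_part F v. radial_bump x s y) \<le> c" if v: "v \<in> Basis \<union> uminus ` Basis" for v
  proof -
    have "finite_measure (jordan_part F v)"
      by (rule finite_measure_jordan_pos[OF F]) (use v in auto)
    from integral_radial_bump_le(2)[OF this _ s, of x] balls[OF v] show ?thesis by simp
  qed
  have "norm (vector_integral F (radial_bump x s)) \<le> (\<Sum>i\<in>(Basis::'a set). 2 * c)"
    unfolding vector_integral_jordan_parts
  proof (rule sum_norm_le)
    fix i :: 'a assume i: "i \<in> Basis"
    let ?p = "LINT y|jordan_part F i. radial_bump x s y"
    let ?n = "LINT y|jordan_part F (- i). radial_bump x s y"
    have "0 \<le> ?p" "0 \<le> ?n" by (simp_all add: radial_bump_nonneg del: inner_minus_right)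
    moreover have "?p \<le> c" "?n \<le> c" using i by (auto intro!: le simp del: inner_minus_right)
    ultimately have "\<bar>?p - ?n\<bar> \<le> 2 * c" by linarith
    then show "norm ((?p - ?n) *\<^sub>R i) \<le> 2 * c" using i by simp
  qed
  then show ?thesis by simp
qed

text \<open>
  Integration by parts: testing \<open>D\<chi>\<^sub>E\<close> with the bump is integrating the gradient of the bump over \<open>E\<close>.
\<close>
lemma norm_vector_integral_bump_le_volume:
  fixes F :: "'a::euclidean_space set \<Rightarrow> 'a"
  assumes DF: "has_distr_derivative (indicator E) F" and E: "E \<in> sets lebesgue" and s: "s > 0"
  shows "norm (vector_integral F (radial_bump x s)) \<le> 4 / s * measure lebesgue (E \<inter> cball x s)"
proof -
  have fin: "E \<inter> cball x s \<in> lmeasurable"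
    by (subst Int_commute, rule fmeasurable_Int_fmeasurable) (use E in auto)
  have "vector_integral F (radial_bump x s) = - (LINT y|lebesgue. indicator E y *\<^sub>R grad (radial_bump x s) y)"
    using DF test_function_radial_bump[OF s, of x] by (simp add: has_distr_derivative_def)
  then have "norm (vector_integral F (radial_bump x s))
      = norm (LINT y|lebesgue. indicator E y *\<^sub>R grad (radial_bump x s) y)" by simp
  also have "\<dots> \<le> (LINT y|lebesgue. norm (indicator E y *\<^sub>R grad (radial_bump x s) y))"
    by (rule integral_norm_bound)
  also have "\<dots> \<le> (LINT y|lebesgue. 4 / s * indicator (E \<inter> cball x s) y)"
  proof (rule integral_mono')
    show "integrable lebesgue (\<lambda>y. 4 / s * indicator (E \<inter> cball x s) y :: real)"
      using fin by (intro integrable_mult_right) (auto simp: integrable_indicator_iff fmeasurable_def)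
    show "norm (indicator E y *\<^sub>R grad (radial_bump x s) y) \<le> 4 / s * indicator (E \<inter> cball x s) y" for y
      using norm_grad_radial_bump_le[OF s, of x y] by (auto simp: indicator_def split: if_splits)
  qed (use s in simp)
  also have "\<dots> = 4 / s * measure lebesgue (E \<inter> cball x s)" by simp
  finally show ?thesis .
qed

text \<open>
  The factor from the normalisation of the potential is increased by \<open>1\<close> so that the constant is
  positive whatever that factor is.
\<close>
definition riesz_bound :: "nat \<Rightarrow> real \<Rightarrow> real" where
  "riesz_bound n \<alpha> = (\<bar>1 / riesz_gamma (real n) \<alpha>\<bar> + 1) / bump_moment (real n - \<alpha>)
     * (2 * real n / \<alpha> + 4 / (1 - \<alpha>))"

lemma riesz_bound_pos:
  assumes "0 < \<alpha>" "\<alpha> < 1" "n > 0"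
  shows "riesz_bound n \<alpha> > 0"
  unfolding riesz_bound_def using assms
  by (intro mult_pos_pos divide_pos_pos bump_moment_pos add_pos_pos add_nonneg_pos) auto

text \<open>
  A Hedberg-type interpolation: \<open>norm (I\<^sub>\<alpha> D\<chi>\<^sub>E)\<close> is bounded by the product of the powers
  \<open>1 - \<alpha>\<close> and \<open>\<alpha>\<close> of the maximal functions of \<open>D\<chi>\<^sub>E\<close> and of \<open>\<chi>\<^sub>E\<close>. The potential is the integral over
  \<open>s\<close> of \<open>s powr (\<alpha> - d - 1)\<close> times \<open>D\<chi>\<^sub>E\<close> tested with the bump of scale \<open>s\<close>. That test is
  \<open>O(a * s powr d)\<close> by the mass bound and \<open>O(b * s powr (d - 1))\<close> by the volume bound.
\<close>
lemma norm_riesz_potential_le: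
  fixes F :: "'a::euclidean_space set \<Rightarrow> 'a"
  assumes \<alpha>: "0 < \<alpha>" "\<alpha> < 1" and F: "finite_vector_measure F"
    and DF: "has_distr_derivative (indicator E) F" and E: "E \<in> sets lebesgue"
    and a: "a > 0" and b: "b > 0"
    and mass: "\<And>v s. v \<in> Basis \<union> uminus ` Basis \<Longrightarrow> s > 0 \<Longrightarrow>
        measure (jordan_part F v) (cball x s) \<le> a * s ^ DIM('a)"
    and vol: "\<And>s. s > 0 \<Longrightarrow> measure lebesgue (E \<inter> cball x s) \<le> b * s ^ DIM('a)"
  shows "norm (riesz_potential \<alpha> F x) \<le> riesz_bound DIM('a) \<alpha> * (a powr (1 - \<alpha>) * b powr \<alpha>)"
proof -
  define d where "d = real DIM('a)"
  define e where "e = d - \<alpha>"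
  have d: "d \<ge> 1" by (simp add: d_def Suc_leI)
  have e: "real DIM('a) - 1 < e" "e < real DIM('a)" "e > 0" using \<alpha> d unfolding e_def d_def by linarith+
  define k where "k = bump_moment e"
  have k: "k > 0" using bump_moment_pos e by (simp add: k_def)
  define B where "B v s = (LINT y|jordan_part F v. radial_bump x s y)" for v s
  define G where "G s = vector_integral F (radial_bump x s)" for s
  have part: "integrable lborel (\<lambda>s. scale_weight e s * B v s)"
    "(LINT y|jordan_part F v. 1 / norm (x - y) powr e) = (LBINT s. scale_weight e s * B v s) / k"
    if v: "v \<in> Basis \<union> uminus ` Basis" for v
  proof -
    have "finite_measure (jordan_part F v)"
      by (rule finite_measure_jordan_pos[OF F]) (use v in auto)
    from integral_riesz_kernel[OF this _ e(1,2) _ mass[OF v]] a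
    show "integrable lborel (\<lambda>s. scale_weight e s * B v s)"
      "(LINT y|jordan_part F v. 1 / norm (x - y) powr e) = (LBINT s. scale_weight e s * B v s) / k"
      by (simp_all add: B_def k_def)
  qed
  have G: "G s = (\<Sum>i\<in>Basis. (B i s - B (- i) s) *\<^sub>R i)" for s
    unfolding G_def B_def by (rule vector_integral_jordan_parts)
  then have wG: "scale_weight e s *\<^sub>R G s
      = (\<Sum>i\<in>Basis. (scale_weight e s * B i s - scale_weight e s * B (- i) s) *\<^sub>R i)" for s
    by (simp add: scaleR_sum_right right_diff_distrib)
  have intG: "integrable lborel (\<lambda>s. scale_weight e s *\<^sub>R G s)"
    unfolding wG by (intro Bochner_Integration.integrable_sum integrable_scaleR_left
        Bochner_Integration.integrable_diff part(1)) auto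
  have "vector_integral F (\<lambda>y. 1 / norm (x - y) powr e)
      = (\<Sum>i\<in>Basis. ((LBINT s. scale_weight e s * B i s) / k - (LBINT s. scale_weight e s * B (- i) s) / k) *\<^sub>R i)"
    unfolding vector_integral_jordan_parts
    by (intro sum.cong refl arg_cong2[where f = "(*\<^sub>R)"] arg_cong2[where f = "(-)"] part(2)) auto
  also have "\<dots> = (1 / k) *\<^sub>R (\<Sum>i\<in>Basis. (LBINT s. (scale_weight e s * B i s - scale_weight e s * B (- i) s) *\<^sub>R i))"
    unfolding scaleR_sum_right
  proof (rule sum.cong[OF refl])
    fix i :: 'a assume "i \<in> Basis"
    then have int: "integrable lborel (\<lambda>s. scale_weight e s * B i s)"
      "integrable lborel (\<lambda>s. scale_weight e s * B (- i) s)" by (auto intro!: part(1))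
    show "((LBINT s. scale_weight e s * B i s) / k - (LBINT s. scale_weight e s * B (- i) s) / k) *\<^sub>R i
      = (1 / k) *\<^sub>R (LBINT s. (scale_weight e s * B i s - scale_weight e s * B (- i) s) *\<^sub>R i)"
      using int by (simp add: diff_divide_distrib)
  qed
  also have "\<dots> = (1 / k) *\<^sub>R (LBINT s. scale_weight e s *\<^sub>R G s)"
    unfolding wG by (subst Bochner_Integration.integral_sum) (auto intro!: integrable_scaleR_left part(1)
        Bochner_Integration.integrable_diff)
  finally have rep: "vector_integral F (\<lambda>y. 1 / norm (x - y) powr e) = (1 / k) *\<^sub>R (LBINT s. scale_weight e s *\<^sub>R G s)" .
  \<comment> \<open>At the scale \<open>b / a\<close> the mass bound and the volume bound for the bumps are equal.\<close>
  define r where "r = b / a"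
  have r: "r > 0" using a b by (simp add: r_def)
  have "norm (LBINT s. scale_weight e s *\<^sub>R G s)
    \<le> (2 * d * a) * (r powr ((\<alpha> - 1) + 1) / ((\<alpha> - 1) + 1))
      + (4 * b) * (- (r powr ((\<alpha> - 2) + 1)) / ((\<alpha> - 2) + 1))"
  proof (rule integral_le_two_powers(2)[OF _ _ r])
    show "(\<lambda>s. scale_weight e s *\<^sub>R G s) \<in> borel_measurable borel"
      using borel_measurable_integrable[OF intG] by simp
    fix s :: real assume s: "0 < s"
    have "norm (G s) \<le> 2 * d * (a * s powr d)"
      unfolding G_def d_def powr_realpow[OF s]
      by (rule norm_vector_integral_bump_le_mass[OF F s mass[OF _ s]])
    then have "norm (scale_weight e s *\<^sub>R G s) \<le> s powr (- e - 1) * (2 * d * (a * s powr d))"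
      using s by (simp add: scale_weight_def mult_left_mono)
    also have "\<dots> = 2 * d * a * s powr (\<alpha> - 1)"
      using s by (simp add: e_def powr_add[symmetric])
    finally show "norm (scale_weight e s *\<^sub>R G s) \<le> 2 * d * a * s powr (\<alpha> - 1)" .
  next
    fix s :: real assume "r \<le> s"
    then have s: "0 < s" using r by simp
    have "norm (G s) \<le> 4 / s * measure lebesgue (E \<inter> cball x s)"
      unfolding G_def by (rule norm_vector_integral_bump_le_volume[OF DF E s])
    also have "\<dots> \<le> 4 / s * (b * s powr d)"
      unfolding d_def powr_realpow[OF s] using s by (intro mult_left_mono vol) auto
    finally have "norm (G s) \<le> 4 / s * (b * s powr d)" .
    from mult_left_mono[OF this, of "s powr (- e - 1)"]
    have "norm (scale_weight e s *\<^sub>R G s) \<le> s powr (- e - 1) * (4 / s * (b * s powr d))"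
      using s by (simp add: scale_weight_def)
    also have "\<dots> = 4 * b * (s powr (- e - 1) * s powr (- 1) * s powr d)"
      using s by (simp add: powr_minus_divide)
    also have "s powr (- e - 1) * s powr (- 1) * s powr d = s powr (\<alpha> - 2)"
      using s by (simp only: powr_add[symmetric]) (simp add: e_def)
    finally show "norm (scale_weight e s *\<^sub>R G s) \<le> 4 * b * s powr (\<alpha> - 2)" .
  qed (use \<alpha> a b d in \<open>auto simp: scale_weight_def\<close>)
  also have "\<dots> = 2 * d / \<alpha> * (a * r powr \<alpha>) + 4 / (1 - \<alpha>) * (b * r powr (\<alpha> - 1))"
  proof -
    have "\<alpha> - 2 + 1 = \<alpha> - 1" by simp
    moreover have "- y / (\<alpha> - 1) = y / (1 - \<alpha>)" for y
      by (metis minus_diff_eq minus_divide_left minus_divide_right)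
    ultimately show ?thesis by simp
  qed
  also have "a * r powr \<alpha> = a powr (1 - \<alpha>) * b powr \<alpha>"
    using a b by (simp add: r_def powr_divide powr_diff)
  also have "b * r powr (\<alpha> - 1) = a powr (1 - \<alpha>) * b powr \<alpha>"
    using a b by (simp add: r_def powr_divide powr_diff)
  finally have int_le: "norm (LBINT s. scale_weight e s *\<^sub>R G s)
      \<le> (2 * d / \<alpha> + 4 / (1 - \<alpha>)) * (a powr (1 - \<alpha>) * b powr \<alpha>)"
    by (simp add: distrib_right)
  have "norm (riesz_potential \<alpha> F x)
      = \<bar>1 / riesz_gamma d \<alpha>\<bar> * (1 / k * norm (LBINT s. scale_weight e s *\<^sub>R G s))"
    unfolding riesz_potential_def d_def[symmetric] e_def[symmetric] rep using k by (simp add: abs_mult)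
  also have "\<dots> \<le> (\<bar>1 / riesz_gamma d \<alpha>\<bar> + 1) * (1 / k * ((2 * d / \<alpha> + 4 / (1 - \<alpha>)) * (a powr (1 - \<alpha>) * b powr \<alpha>)))"
    using k int_le by (intro mult_mono mult_left_mono) auto
  finally show ?thesis
    by (simp add: riesz_bound_def k_def e_def d_def)
qed

section \<open>Decay of the distribution function\<close>

text \<open>
  Where neither maximal function is large, the potential is at most \<open>t\<close>. The set \<open>W\<close> covers the
  points where the maximal function of \<open>\<chi>\<^sub>E\<close> exceeds \<open>b\<close>; it is left arbitrary so that it can be taken
  empty once \<open>b\<close> is the volume of the unit ball.
\<close>
lemma emeasure_level_set_le:
  fixes F :: "'a::euclidean_space set \<Rightarrow> 'a"
  assumes \<alpha>: "0 < \<alpha>" "\<alpha> < 1" and F: "finite_vector_measure F"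
    and DF: "has_distr_derivative (indicator E) F" and E: "E \<in> sets lebesgue"
    and P: "vector_total_variation F UNIV \<le> ennreal P" "P \<ge> 0"
    and a: "a > 0" and b: "b > 0"
    and t: "riesz_bound DIM('a) \<alpha> * (a powr (1 - \<alpha>) * b powr \<alpha>) \<le> t"
    and W: "W \<in> sets borel"
    and vol: "\<And>x s. x \<notin> W \<Longrightarrow> s > 0 \<Longrightarrow> measure lebesgue (E \<inter> cball x s) \<le> b * s ^ DIM('a)"
  shows "emeasure lebesgue {x. norm (riesz_potential \<alpha> F x) > t}
    \<le> ennreal (2 * real DIM('a) * (unit_ball_vol (real DIM('a)) * 5 ^ DIM('a) * P / a)) + emeasure lborel W"
proof -
  define c where "c = unit_ball_vol (real DIM('a)) * 5 ^ DIM('a) * P / a"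
  have c: "c \<ge> 0" using P a by (simp add: c_def)
  define bad where "bad v = {x. \<exists>s>0. ennreal (a * s ^ DIM('a)) < emeasure (jordan_part F v) (cball x s)}" for v
  have "\<exists>U. U \<in> sets borel \<and> bad v \<subseteq> U \<and> emeasure lborel U \<le> ennreal c"
    if v: "v \<in> Basis \<union> uminus ` Basis" for v
  proof -
    have "emeasure (jordan_part F v) UNIV \<le> vector_total_variation F UNIV"
      by (rule emeasure_jordan_pos_le[OF F]) (use v in auto)
    then have "emeasure (jordan_part F v) (space (jordan_part F v)) \<le> ennreal P"
      using P(1) by (simp add: order_trans)
    then obtain U where "U \<in> sets borel" "emeasure lborel U \<le> ennreal c" "bad v \<subseteq> U"
      unfolding c_def bad_def by (rule large_balls_covered[OF _ _ P(2) a, rotated]) simp_all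
    then show ?thesis by blast
  qed
  then have "\<forall>v\<in>Basis \<union> uminus ` Basis. \<exists>U. U \<in> sets borel \<and> bad v \<subseteq> U \<and> emeasure lborel U \<le> ennreal c"
    by blast
  from bchoice[OF this] obtain U where U: "\<And>v. v \<in> Basis \<union> uminus ` Basis \<Longrightarrow> U v \<in> sets borel"
    "\<And>v. v \<in> Basis \<union> uminus ` Basis \<Longrightarrow> bad v \<subseteq> U v"
    "\<And>v. v \<in> Basis \<union> uminus ` Basis \<Longrightarrow> emeasure lborel (U v) \<le> ennreal c"
    by blast
  define V where "V = (\<Union>i\<in>Basis. U i \<union> U (- i))"
  have V: "V \<in> sets borel" unfolding V_def using U(1) by (intro sets.finite_UN finite_Basis sets.Un) auto
  have "emeasure lborel V \<le> (\<Sum>i\<in>(Basis::'a set). emeasure lborel (U i \<union> U (- i)))"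
    unfolding V_def by (rule emeasure_subadditive_finite) (use U(1) in \<open>auto intro!: sets.Un\<close>)
  also have "\<dots> \<le> (\<Sum>i\<in>(Basis::'a set). ennreal (2 * c))"
  proof (rule sum_mono)
    fix i :: 'a assume i: "i \<in> Basis"
    have "emeasure lborel (U i \<union> U (- i)) \<le> emeasure lborel (U i) + emeasure lborel (U (- i))"
      by (rule emeasure_subadditive) (use U(1) i in auto)
    also have "\<dots> \<le> ennreal c + ennreal c" by (intro add_mono U(3)) (use i in auto)
    also have "\<dots> = ennreal (2 * c)" using c by (simp add: ennreal_plus[symmetric] del: ennreal_plus)
    finally show "emeasure lborel (U i \<union> U (- i)) \<le> ennreal (2 * c)" .
  qed
  also have "\<dots> = ennreal (2 * real DIM('a) * c)"
    using c by (simp add: ennreal_of_nat_eq_real_of_nat ennreal_mult[symmetric] mult.commute mult.left_commute)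
  finally have Vle: "emeasure lborel V \<le> ennreal (2 * real DIM('a) * c)" .
  have sub: "{x. norm (riesz_potential \<alpha> F x) > t} \<subseteq> V \<union> W"
  proof safe
    fix x assume x: "t < norm (riesz_potential \<alpha> F x)" and xW: "x \<notin> W"
    show "x \<in> V"
    proof (rule ccontr)
      assume xV: "x \<notin> V"
      have "norm (riesz_potential \<alpha> F x) \<le> riesz_bound DIM('a) \<alpha> * (a powr (1 - \<alpha>) * b powr \<alpha>)"
      proof (rule norm_riesz_potential_le[OF \<alpha> F DF E a b])
        fix v :: 'a and s :: real assume v: "v \<in> Basis \<union> uminus ` Basis" and s: "s > 0"
        have "x \<notin> U v" using xV v by (auto simp: V_def)
        then have "\<not> ennreal (a * s ^ DIM('a)) < emeasure (jordan_part F v) (cball x s)"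
          using U(2)[OF v] s unfolding bad_def by blast
        then have "emeasure (jordan_part F v) (cball x s) \<le> ennreal (a * s ^ DIM('a))"
          by (simp add: not_less)
        then show "measure (jordan_part F v) (cball x s) \<le> a * s ^ DIM('a)"
          using a s by (auto simp: measure_def intro!: enn2real_leI)
      qed (use vol xW in auto)
      then show False using x t by linarith
    qed
  qed
  show ?thesis
  proof (cases "{x. norm (riesz_potential \<alpha> F x) > t} \<in> sets lebesgue")
    case True
    have "emeasure lebesgue {x. norm (riesz_potential \<alpha> F x) > t} \<le> emeasure lebesgue (V \<union> W)"
      by (rule emeasure_mono[OF sub]) (use V W in auto)
    also have "\<dots> = emeasure lborel (V \<union> W)" using V W by simp
    also have "\<dots> \<le> emeasure lborel V + emeasure lborel W"
      by (rule emeasure_subadditive) (use V W in auto)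
    also have "\<dots> \<le> ennreal (2 * real DIM('a) * c) + emeasure lborel W"
      by (intro add_right_mono Vle)
    finally show ?thesis unfolding c_def .
  qed (simp add: emeasure_notin_sets)
qed

definition low_level_const :: "nat \<Rightarrow> real \<Rightarrow> real" where
  "low_level_const n \<alpha> = unit_ball_vol (real n) * 5 ^ n * (2 * real n + 1) * riesz_bound n \<alpha>"

definition high_level_const :: "nat \<Rightarrow> real \<Rightarrow> real" where
  "high_level_const n \<alpha> = unit_ball_vol (real n) * 5 ^ n * (2 * real n)
     * (riesz_bound n \<alpha> * unit_ball_vol (real n) powr \<alpha>) powr (1 / (1 - \<alpha>))"

text \<open>
  The exponents in \<open>a\<close> and \<open>b\<close> are those for which \<open>P / a = V / b\<close>, so that both exceptional sets
  have bounds of the same size, while \<open>a powr (1 - \<alpha>) * b powr \<alpha>\<close> stays proportional to \<open>t\<close>.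
\<close>
lemma emeasure_level_set_low:
  fixes F :: "'a::euclidean_space set \<Rightarrow> 'a"
  assumes \<alpha>: "0 < \<alpha>" "\<alpha> < 1" and F: "finite_vector_measure F"
    and DF: "has_distr_derivative (indicator E) F" and E: "E \<in> sets lebesgue"
    and P: "vector_total_variation F UNIV \<le> ennreal P" "P > 0"
    and V: "emeasure lebesgue E \<le> ennreal V" "V > 0" and t: "t > 0"
  shows "emeasure lebesgue {x. norm (riesz_potential \<alpha> F x) > t}
    \<le> ennreal (low_level_const DIM('a) \<alpha> * (P powr (1 - \<alpha>) * V powr \<alpha>) / t)"
proof -
  define K where "K = riesz_bound DIM('a) \<alpha>"
  have K: "K > 0" using riesz_bound_pos[OF \<alpha>] by (simp add: K_def)
  define c where "c = unit_ball_vol (real DIM('a)) * 5 ^ DIM('a)"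
  have c: "c \<ge> 0" by (simp add: c_def)
  define a where "a = (P / V) powr \<alpha> * (t / K)"
  define b where "b = (V / P) powr (1 - \<alpha>) * (t / K)"
  have ab: "a > 0" "b > 0" using P V t K by (auto simp: a_def b_def)
  have "a powr (1 - \<alpha>) * b powr \<alpha> = (P / V) powr (\<alpha> * (1 - \<alpha>)) * (V / P) powr (\<alpha> * (1 - \<alpha>))
      * ((t / K) powr (1 - \<alpha>) * (t / K) powr \<alpha>)"
    using P V t K by (simp add: a_def b_def powr_mult powr_powr mult_ac del: times_divide_eq_right times_divide_eq_left)
  also have "(t / K) powr (1 - \<alpha>) * (t / K) powr \<alpha> = t / K"
    using t K by (simp add: powr_add[symmetric])
  also have "(P / V) powr (\<alpha> * (1 - \<alpha>)) * (V / P) powr (\<alpha> * (1 - \<alpha>)) = 1"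
    using P V by (simp add: powr_divide)
  finally have Kt: "K * (a powr (1 - \<alpha>) * b powr \<alpha>) \<le> t" using K by simp
  have "P / a = P powr (1 - \<alpha>) * V powr \<alpha> * K / t"
    using P V t K by (simp add: a_def powr_divide powr_diff field_simps)
  then have Pa: "c * P / a = c * (P powr (1 - \<alpha>) * V powr \<alpha> * K / t)" by (metis times_divide_eq_right)
  have "V / b = P powr (1 - \<alpha>) * V powr \<alpha> * K / t"
    using P V t K by (simp add: b_def powr_divide powr_diff field_simps)
  then have Vb: "c * V / b = c * (P powr (1 - \<alpha>) * V powr \<alpha> * K / t)" by (metis times_divide_eq_right)
  define M where "M = density lebesgue (indicator E :: 'a \<Rightarrow> ennreal)"
  have M: "emeasure M X = emeasure lebesgue (E \<inter> X)" if "X \<in> sets lebesgue" for X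
    unfolding M_def by (rule emeasure_restricted[OF E that])
  have sM: "sets borel \<subseteq> sets M" by (auto simp: M_def)
  have "emeasure M (space M) \<le> ennreal V"
    using V(1) by (subst M) (auto simp: M_def)
  from large_balls_covered[OF sM this _ ab(2)] V(2)
  obtain W where W: "W \<in> sets borel"
    "{x. \<exists>s>0. ennreal (b * s ^ DIM('a)) < emeasure M (cball x s)} \<subseteq> W"
    "emeasure lborel W \<le> ennreal (c * V / b)" unfolding c_def by auto
  have "emeasure lebesgue {x. norm (riesz_potential \<alpha> F x) > t}
    \<le> ennreal (2 * real DIM('a) * (c * P / a)) + emeasure lborel W"
    unfolding c_def
  proof (rule emeasure_level_set_le[OF \<alpha> F DF E P(1) _ ab Kt[unfolded K_def] W(1)])
    fix x s assume x: "x \<notin> W" and s: "0 < (s::real)"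
    have "\<not> ennreal (b * s ^ DIM('a)) < emeasure M (cball x s)"
      using W(2) x s by blast
    then have "emeasure M (cball x s) \<le> ennreal (b * s ^ DIM('a))"
      by (simp add: not_less)
    then have "emeasure lebesgue (E \<inter> cball x s) \<le> ennreal (b * s ^ DIM('a))"
      by (subst (asm) M) auto
    then show "measure lebesgue (E \<inter> cball x s) \<le> b * s ^ DIM('a)"
      using ab s by (auto simp: measure_def intro!: enn2real_leI)
  qed (use P in auto)
  also have "\<dots> \<le> ennreal (2 * real DIM('a) * (c * P / a)) + ennreal (c * V / b)"
    by (intro add_left_mono W(3))
  also have "\<dots> = ennreal (2 * real DIM('a) * (c * P / a) + c * V / b)"
    using c P V ab by (intro ennreal_plus[symmetric]) auto
  finally show ?thesis
    unfolding Pa Vb by (simp add: low_level_const_def c_def K_def algebra_simps add_divide_distrib)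
qed

text \<open>
  This is where it matters that \<open>\<chi>\<^sub>E\<close> is bounded: \<open>E\<close> fills at most the whole of any ball, so with
  \<open>b\<close> the volume of the unit ball only the mass of \<open>F\<close> contributes, and the decay in \<open>t\<close>
  is faster than in \<open>emeasure_level_set_low\<close>.
\<close>
lemma emeasure_level_set_high:
  fixes F :: "'a::euclidean_space set \<Rightarrow> 'a"
  assumes \<alpha>: "0 < \<alpha>" "\<alpha> < 1" and F: "finite_vector_measure F"
    and DF: "has_distr_derivative (indicator E) F" and E: "E \<in> sets lebesgue"
    and P: "vector_total_variation F UNIV \<le> ennreal P" "P > 0" and t: "t > 0"
  shows "emeasure lebesgue {x. norm (riesz_potential \<alpha> F x) > t}
    \<le> ennreal (high_level_const DIM('a) \<alpha> * P * t powr (- (1 / (1 - \<alpha>))))"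
proof -
  define K where "K = riesz_bound DIM('a) \<alpha>"
  have K: "K > 0" using riesz_bound_pos[OF \<alpha>] by (simp add: K_def)
  define b where "b = unit_ball_vol (real DIM('a))"
  have b: "b > 0" by (simp add: b_def)
  define c where "c = b * 5 ^ DIM('a)"
  define a where "a = (t / (K * b powr \<alpha>)) powr (1 / (1 - \<alpha>))"
  have a: "a > 0" using t K b by (simp add: a_def)
  have "1 / a = (K * b powr \<alpha>) powr (1 / (1 - \<alpha>)) * t powr (- (1 / (1 - \<alpha>)))"
    using t K b by (simp add: a_def powr_divide powr_minus_divide)
  then have Pa: "c * P / a = c * P * ((K * b powr \<alpha>) powr (1 / (1 - \<alpha>)) * t powr (- (1 / (1 - \<alpha>))))"
    by (metis times_divide_eq_right mult.right_neutral)
  have "a powr (1 - \<alpha>) = t / (K * b powr \<alpha>)"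
    using t K b \<alpha> by (simp add: a_def powr_powr)
  then have Kt: "K * (a powr (1 - \<alpha>) * b powr \<alpha>) \<le> t" using K b by simp
  have "emeasure lebesgue {x. norm (riesz_potential \<alpha> F x) > t}
    \<le> ennreal (2 * real DIM('a) * (c * P / a)) + emeasure lborel ({} :: 'a set)"
    unfolding c_def b_def
  proof (rule emeasure_level_set_le[OF \<alpha> F DF E P(1) _ a b Kt[unfolded K_def], unfolded b_def])
    fix x :: 'a and s :: real assume s: "0 < s"
    have "measure lebesgue (E \<inter> cball x s) \<le> measure lebesgue (cball x s)"
      by (rule measure_mono_fmeasurable) (use E in auto)
    also have "\<dots> = unit_ball_vol (real DIM('a)) * s ^ DIM('a)"
      using s by (simp add: content_cball)
    finally show "measure lebesgue (E \<inter> cball x s) \<le> unit_ball_vol (real DIM('a)) * s ^ DIM('a)" .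
  qed (use P in auto)
  then show ?thesis
    unfolding Pa by (simp add: high_level_const_def c_def b_def K_def mult_ac)
qed

lemma ennreal_powr_le:
  assumes "x \<le> ennreal c" "c \<ge> 0" "e \<ge> 0"
  shows "ennreal_powr x e \<le> ennreal (c powr e)"
proof -
  have "x \<noteq> \<infinity>" using assms(1) by (auto simp: top_unique)
  moreover have "enn2real x \<le> c" using assms by (intro enn2real_leI)
  ultimately show ?thesis using assms
    by (auto simp: ennreal_powr_def intro!: ennreal_leI powr_mono2)
qed

definition lorentz_const :: "nat \<Rightarrow> real \<Rightarrow> real" where
  "lorentz_const n \<alpha> = (let \<theta> = 1 - \<alpha> / real n in
     low_level_const n \<alpha> powr \<theta> / (1 - \<theta>) + high_level_const n \<alpha> powr \<theta> / (\<theta> / (1 - \<alpha>) - 1))"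

text \<open>
  With \<open>\<theta> = 1 - \<alpha> / d\<close>, the integrand of the quasi-norm is \<open>O(t powr (- \<theta>))\<close> by the first decay
  bound, integrable at \<open>0\<close> since \<open>\<theta> < 1\<close>, and \<open>O(t powr (- \<theta> / (1 - \<alpha>)))\<close> by the second, integrable
  at infinity since \<open>1 - \<alpha> < \<theta>\<close>; the last inequality is \<open>d > 1\<close>.
\<close>
lemma lorentz_norm_riesz_potential_le:
  fixes F :: "'a::euclidean_space set \<Rightarrow> 'a"
  assumes d: "DIM('a) \<ge> 2" and \<alpha>: "0 < \<alpha>" "\<alpha> < 1" and F: "finite_vector_measure F"
    and DF: "has_distr_derivative (indicator E) F" and E: "E \<in> sets lebesgue"
    and P: "vector_total_variation F UNIV \<le> ennreal P" "P > 0"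
    and V: "emeasure lebesgue E \<le> ennreal V" "V > 0"
  shows "lorentz_norm1 (real DIM('a) / (real DIM('a) - \<alpha>)) (riesz_potential \<alpha> F)
    \<le> ennreal (lorentz_const DIM('a) \<alpha> * (P powr (1 - \<alpha>) * V powr (\<alpha> * (1 - 1 / real DIM('a)))))"
proof -
  define d where "d = real DIM('a)"
  have d2: "d \<ge> 2" using d by (simp add: d_def)
  define \<theta> where "\<theta> = 1 - \<alpha> / d"
  define C1 where "C1 = low_level_const DIM('a) \<alpha>"
  define C2 where "C2 = high_level_const DIM('a) \<alpha>"
  have Kpos: "riesz_bound DIM('a) \<alpha> > 0" using riesz_bound_pos[OF \<alpha>] by simp
  have C: "C1 \<ge> 0" "C2 \<ge> 0"
    using Kpos by (auto simp: C1_def C2_def low_level_const_def high_level_const_def)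
  have \<theta>: "0 < \<theta>" "\<theta> < 1" "1 - \<alpha> < \<theta>"
  proof -
    have "\<alpha> / d < \<alpha>" using \<alpha> d2 by (simp add: field_simps)
    then show "0 < \<theta>" "1 - \<alpha> < \<theta>" using \<alpha> by (auto simp: \<theta>_def)
    show "\<theta> < 1" using \<alpha> d2 by (simp add: \<theta>_def)
  qed
  have \<theta>': "\<theta> / (1 - \<alpha>) > 1" using \<theta> \<alpha> by simp
  have inv: "1 / (d / (d - \<alpha>)) = \<theta>" using d2 by (simp add: \<theta>_def diff_divide_distrib)
  define X where "X = P powr (1 - \<alpha>) * V powr (\<alpha> * (1 - 1 / d))"
  \<comment> \<open>At this level the two decay bounds agree up to a constant; both parts are then multiples of \<open>X\<close>.\<close>
  define r where "r = (P / V) powr (1 - \<alpha>)"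
  have r: "r > 0" using P V by (simp add: r_def)
  define D where "D t = emeasure lebesgue {x. norm (riesz_potential \<alpha> F x) > t}" for t
  have "lorentz_norm1 (d / (d - \<alpha>)) (riesz_potential \<alpha> F)
      = (\<integral>\<^sup>+t\<in>{0<..}. ennreal_powr (D t) \<theta> \<partial>lborel)"
    unfolding lorentz_norm1_def inv D_def ..
  also have "\<dots> \<le> ennreal ((C1 * (P powr (1 - \<alpha>) * V powr \<alpha>)) powr \<theta> * (r powr (- \<theta> + 1) / (- \<theta> + 1))
      + (C2 * P) powr \<theta> * (- (r powr (- (\<theta> / (1 - \<alpha>)) + 1)) / (- (\<theta> / (1 - \<alpha>)) + 1)))"
  proof (rule nn_integral_le_two_powers[OF _ _ r])
    fix t :: real assume t: "0 < t"
    have "ennreal_powr (D t) \<theta> \<le> ennreal ((C1 * (P powr (1 - \<alpha>) * V powr \<alpha>) / t) powr \<theta>)"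
      using C t P V \<theta> unfolding D_def C1_def
      by (intro ennreal_powr_le emeasure_level_set_low[OF \<alpha> F DF E P V t]) (auto simp: C1_def)
    also have "(C1 * (P powr (1 - \<alpha>) * V powr \<alpha>) / t) powr \<theta> = (C1 * (P powr (1 - \<alpha>) * V powr \<alpha>)) powr \<theta> * t powr (- \<theta>)"
      using C P V t by (simp add: powr_divide powr_minus_divide)
    finally show "ennreal_powr (D t) \<theta> \<le> ennreal ((C1 * (P powr (1 - \<alpha>) * V powr \<alpha>)) powr \<theta> * t powr (- \<theta>))" .
  next
    fix t :: real assume "r \<le> t"
    then have t: "t > 0" using r by simp
    have "ennreal_powr (D t) \<theta> \<le> ennreal ((C2 * P * t powr (- (1 / (1 - \<alpha>)))) powr \<theta>)"
      using C t P \<theta> unfolding D_def C2_def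
      by (intro ennreal_powr_le emeasure_level_set_high[OF \<alpha> F DF E P t]) (auto simp: C2_def)
    also have "(C2 * P * t powr (- (1 / (1 - \<alpha>)))) powr \<theta> = (C2 * P) powr \<theta> * t powr (- (\<theta> / (1 - \<alpha>)))"
      using C P t by (simp add: powr_mult powr_powr)
    finally show "ennreal_powr (D t) \<theta> \<le> ennreal ((C2 * P) powr \<theta> * t powr (- (\<theta> / (1 - \<alpha>))))" .
  qed (use \<theta> \<theta>' in auto)
  also have "(C1 * (P powr (1 - \<alpha>) * V powr \<alpha>)) powr \<theta> * (r powr (- \<theta> + 1) / (- \<theta> + 1))
      = C1 powr \<theta> / (1 - \<theta>) * X"
  proof -
    have "(P powr (1 - \<alpha>) * V powr \<alpha>) powr \<theta> * r powr (1 - \<theta>)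
        = (P powr ((1 - \<alpha>) * \<theta>) * P powr ((1 - \<alpha>) * (1 - \<theta>)))
          * (V powr (\<alpha> * \<theta>) * V powr (- ((1 - \<alpha>) * (1 - \<theta>))))"
      using P V by (simp add: r_def powr_mult powr_divide powr_powr powr_minus_divide)
    also have "\<dots> = X"
      unfolding powr_add[symmetric] X_def
    proof (intro arg_cong2[where f = "(*)"] arg_cong2[where f = "(powr)"] refl)
      show "(1 - \<alpha>) * \<theta> + (1 - \<alpha>) * (1 - \<theta>) = 1 - \<alpha>" by (simp add: algebra_simps)
      show "\<alpha> * \<theta> + - ((1 - \<alpha>) * (1 - \<theta>)) = \<alpha> * (1 - 1 / d)"
        by (simp add: \<theta>_def algebra_simps diff_divide_distrib)
    qed
    finally show ?thesis using C P V by (simp add: powr_mult)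
  qed
  also have "(C2 * P) powr \<theta> * (- (r powr (- (\<theta> / (1 - \<alpha>)) + 1)) / (- (\<theta> / (1 - \<alpha>)) + 1))
      = C2 powr \<theta> / (\<theta> / (1 - \<alpha>) - 1) * X"
  proof -
    have "P powr \<theta> * r powr (1 - \<theta> / (1 - \<alpha>))
        = (P powr \<theta> * P powr ((1 - \<alpha>) * (1 - \<theta> / (1 - \<alpha>)))) * V powr (- ((1 - \<alpha>) * (1 - \<theta> / (1 - \<alpha>))))"
      using P V by (simp add: r_def powr_divide powr_powr powr_minus_divide)
    also have "\<dots> = X"
      unfolding powr_add[symmetric] X_def
    proof (intro arg_cong2[where f = "(*)"] arg_cong2[where f = "(powr)"] refl)
      have *: "(1 - \<alpha>) * (1 - \<theta> / (1 - \<alpha>)) = 1 - \<alpha> - \<theta>" using \<alpha> by (simp add: right_diff_distrib)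
      show "\<theta> + (1 - \<alpha>) * (1 - \<theta> / (1 - \<alpha>)) = 1 - \<alpha>" unfolding * by simp
      show "- ((1 - \<alpha>) * (1 - \<theta> / (1 - \<alpha>))) = \<alpha> * (1 - 1 / d)"
        unfolding * by (simp add: \<theta>_def algebra_simps)
    qed
    finally have X: "P powr \<theta> * r powr (1 - \<theta> / (1 - \<alpha>)) = X" .
    have neg: "- y / (- w + 1) = y / (w - 1)" for y w :: real
      by (metis minus_diff_eq minus_divide_left minus_divide_right uminus_add_conv_diff add.commute)
    show ?thesis unfolding neg using C P X by (simp add: powr_mult)
  qed
  finally show ?thesis
    by (simp add: lorentz_const_def Let_def \<theta>_def C1_def C2_def X_def d_def distrib_right)
qed

section \<open>The Lorentz estimate\<close>
theorem lemma1p2: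
  fixes \<alpha> :: real
  assumes "DIM('a::euclidean_space) \<ge> 2" and "0 < \<alpha>" and "\<alpha> < 1"
  shows "\<exists>C > 0. \<forall>E :: 'a set. E \<in> sets lebesgue \<longrightarrow> (indicator E :: 'a \<Rightarrow> real) \<in> BV \<longrightarrow>
    lorentz_norm1 (real DIM('a) / (real DIM('a) - \<alpha>))
        (riesz_potential \<alpha> (distr_derivative (indicator E)))
      \<le> ennreal C * ennreal_powr (perimeter E) (1 - \<alpha>)
          * ennreal_powr (emeasure lebesgue E) (\<alpha> * (1 - 1 / real DIM('a)))"
proof (intro exI conjI allI impI)
  define C where "C = \<bar>lorentz_const DIM('a) \<alpha>\<bar> + 1"
  show C: "C > 0" by (simp add: C_def)
  fix E :: "'a set"
  assume E: "E \<in> sets lebesgue" and BV: "(indicator E :: 'a \<Rightarrow> real) \<in> BV"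
  define F where "F = distr_derivative (indicator E :: 'a \<Rightarrow> real)"
  have "\<exists>F. finite_vector_measure F \<and> has_distr_derivative (indicator E :: 'a \<Rightarrow> real) F"
    using BV by (simp add: BV_def)
  from someI_ex[OF this] have F: "finite_vector_measure F" "has_distr_derivative (indicator E) F"
    by (simp_all add: F_def distr_derivative_def)
  define \<beta> where "\<beta> = \<alpha> * (1 - 1 / real DIM('a))"
  have \<beta>: "\<beta> > 0" using assms by (simp add: \<beta>_def)
  have per: "perimeter E = vector_total_variation F UNIV" by (simp add: perimeter_def F_def)
  have per_fin: "perimeter E < \<infinity>" using F(1) per by (simp add: finite_vector_measure_def)
  have vol_fin: "emeasure lebesgue E < \<infinity>"
    using BV E by (simp add: BV_def integrable_indicator_iff)
  define P where "P = enn2real (perimeter E)"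
  define V where "V = enn2real (emeasure lebesgue E)"
  have P: "perimeter E = ennreal P" "P \<ge> 0" using per_fin by (simp_all add: P_def)
  have V: "emeasure lebesgue E = ennreal V" "V \<ge> 0" using vol_fin by (simp_all add: V_def)
  \<comment> \<open>The estimate divides by the perimeter and the volume; adding \<open>\<epsilon>\<close> covers the case that one of them is \<open>0\<close>.\<close>
  define \<epsilon> where "\<epsilon> n = 1 / real (Suc n)" for n
  have \<epsilon>: "\<epsilon> n > 0" for n by (simp add: \<epsilon>_def)
  have \<epsilon>_lim: "\<epsilon> \<longlonglongrightarrow> 0"
    unfolding \<epsilon>_def[abs_def] using LIMSEQ_inverse_real_of_nat by (simp add: inverse_eq_divide)
  define L where "L = lorentz_norm1 (real DIM('a) / (real DIM('a) - \<alpha>)) (riesz_potential \<alpha> F)"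
  have "L \<le> ennreal (C * ((P + \<epsilon> n) powr (1 - \<alpha>) * (V + \<epsilon> n) powr \<beta>))" for n
  proof -
    have "L \<le> ennreal (lorentz_const DIM('a) \<alpha> * ((P + \<epsilon> n) powr (1 - \<alpha>) * (V + \<epsilon> n) powr \<beta>))"
      unfolding L_def \<beta>_def
    proof (rule lorentz_norm_riesz_potential_le[OF assms F E])
      show "vector_total_variation F UNIV \<le> ennreal (P + \<epsilon> n)"
        using P \<epsilon>[of n] per by (simp add: ennreal_leI)
      show "emeasure lebesgue E \<le> ennreal (V + \<epsilon> n)"
        using V \<epsilon>[of n] by (simp add: ennreal_leI)
    qed (use P V \<epsilon>[of n] in \<open>auto intro: add_nonneg_pos\<close>)
    also have "\<dots> \<le> ennreal (C * ((P + \<epsilon> n) powr (1 - \<alpha>) * (V + \<epsilon> n) powr \<beta>))"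
      by (intro ennreal_leI mult_right_mono) (auto simp: C_def)
    finally show ?thesis .
  qed
  moreover have "(\<lambda>n. ennreal (C * ((P + \<epsilon> n) powr (1 - \<alpha>) * (V + \<epsilon> n) powr \<beta>)))
      \<longlonglongrightarrow> ennreal (C * ((P + 0) powr (1 - \<alpha>) * (V + 0) powr \<beta>))"
    using P(2) V(2) assms \<beta> \<epsilon>
    by (intro tendsto_ennrealI tendsto_mult tendsto_powr' tendsto_add tendsto_const \<epsilon>_lim)
       (auto intro!: always_eventually add_nonneg_nonneg less_imp_le)
  ultimately have "L \<le> ennreal (C * ((P + 0) powr (1 - \<alpha>) * (V + 0) powr \<beta>))"
    by (intro LIMSEQ_le_const) auto
  also have "\<dots> = ennreal C * ennreal_powr (perimeter E) (1 - \<alpha>) * ennreal_powr (emeasure lebesgue E) \<beta>"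
    using P V C by (simp add: ennreal_powr_def ennreal_mult mult.assoc)
  finally show "lorentz_norm1 (real DIM('a) / (real DIM('a) - \<alpha>))
        (riesz_potential \<alpha> (distr_derivative (indicator E)))
      \<le> ennreal C * ennreal_powr (perimeter E) (1 - \<alpha>)
          * ennreal_powr (emeasure lebesgue E) (\<alpha> * (1 - 1 / real DIM('a)))"
    unfolding L_def F_def \<beta>_def .
qed

end
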